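(* Let $F(z)$ be a $p\times m$-valued Finite Impulse Response function (Laurent polynomial with coefficients in $\mathbb{C}^{p\times m}$) of McMillan degree $d$. I. Assume $p\ge m$. Then $F(z)$ is isometrically in $\mathcal{U}$ if and only if there exist an integer $\gamma\in[0,d]$, vectors $v_1,\dots,v_d\in\mathbb{C}^p$ with $v_j^*v_j=1$, and $U_{\rm iso}\in\mathbb{C}^{p\times m}$ with $U_{\rm iso}^*U_{\rm iso}=I_m$, such that $F$ can be written in one, and hence in each, of the following three equivalent forms: $$F(z)=\prod_{j=1}^{\gamma}\left(I_p+(z-1)v_jv_j^*\right)\prod_{j=\gamma+1}^{d}\left(I_p+(\tfrac1z-1)v_jv_j^*\right)U_{\rm iso},$$ $$F(z)=\prod_{j=1}^{\gamma}\left(I_p+(z-1)v_jv_j^*\right)\left(\prod_{j=d}^{\gamma+1}\left(I_p+(z-1)v_jv_j^*\right)\right)^{-1}U_{\rm iso},$$ $$F(z)=\left(\prod_{j=\gamma}^{1}\left(I_p+(\tfrac1z-1)v_jv_j^*\right)\right)^{-1}\prod_{j=\gamma+1}^{d}\left(I_p+(\tfrac1z-1)v_jv_j^*\right)U_{\rm iso}.$$ II. Assume $m\ge p$. Then $F(z)$ is co-isometrically in $\mathcal{U}$ if and only if there exist an integer $\gamma\in[0,d]$, vectors $v_1,\dots,v_d\in\mathbb{C}^m$ with $v_j^*v_j=1$, and $U_{\rm coiso}\in\mathbb{C}^{p\times m}$ with $U_{\rm coiso}U_{\rm coiso}^*=I_p$, such that $F$ can be written in one, and hence in each, of the following three equivalent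 forms: $$F(z)=U_{\rm coiso}\prod_{j=\gamma+1}^{d}\left(I_m+(\tfrac1z-1)v_jv_j^*\right)\prod_{j=1}^{\gamma}\left(I_m+(z-1)v_jv_j^*\right),$$ $$F(z)=U_{\rm coiso}\left(\prod_{j=d}^{\gamma+1}\left(I_m+(z-1)v_jv_j^*\right)\right)^{-1}\prod_{j=1}^{\gamma}\left(I_m+(z-1)v_jv_j^*\right),$$ $$F(z)=U_{\rm coiso}\prod_{j=\gamma+1}^{d}\left(I_m+(\tfrac1z-1)v_jv_j^*\right)\left(\prod_{j=\gamma}^{1}\left(I_m+(\tfrac1z-1)v_jv_j^*\right)\right)^{-1}.$$ In particular, in each of these forms $F(z)$ is causal for $\gamma=0$ and anti-causal for $\gamma=d$.
   Context: Products of matrices are ordered from left to right in the order in which the index runs: $\prod_{j=a}^{b}M_j=M_aM_{a+1}\cdots M_b$ for an increasing index, and $\prod_{j=b}^{a}M_j=M_bM_{b-1}\cdots M_a$ with $b\geq a$ for a decreasing index; empty products are the identity. A Finite Impulse Response (FIR) function is a matrix-valued Laurent polynomial $F(z)=z^{q}(z^{-1}B_1+\cdots+z^{-n}B_n)$ with $n$ natural, $q$ an integer, $B_j\in\mathbb{C}^{p\times m}$. It is causal if only non-positive powers of $z$ occur ($q\le 1$) and anti-causal if only non-negative powers of $z$ occur ($q\ge n$). With $\mathbb{T}=\{z\in\mathbb{C}:|z|=1\}$, the class $\mathcal{U}$ consists of the $p\times m$-valued rational functions with $F(z)^*F(z)=I_m$ for all $z\in\mathbb{T}$ if $p\ge m$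 ($F$ is isometrically in $\mathcal{U}$), and $F(z)F(z)^*=I_p$ for all $z\in\mathbb{T}$ if $m\ge p$ ($F$ is co-isometrically in $\mathcal{U}$). McMillan degree: for a rational function $G$ with no pole at infinity it is the smallest $\nu$ such that $G(z)=C(zI_\nu-A)^{-1}B+D$ for constant matrices $A\in\mathbb{C}^{\nu\times\nu},B,C,D$. For a Laurent polynomial $F=F_l+D+F_r$, where $D$ is constant, $F_l$ contains the strictly positive powers of $z$ and $F_r$ the strictly negative powers, it is the sum of the McMillan degrees of $F_r(z)$ and of $F_l(1/z)$. *)

theory Defs
  imports "Jordan_Normal_Form.Schur_Decomposition"
begin

text \<open>
  Matrix-valued functions have type \<^typ>\<open>complex \<Rightarrow> complex mat\<close>.  A Laurent polynomial is
  determined by its values at \<open>z \<noteq> 0\<close>, and its value at \<open>0\<close> is irrelevant throughout.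
\<close>

definition mat_inv :: "complex mat \<Rightarrow> complex mat" where
  "mat_inv M = the (mat_inverse M)"

text \<open>The product of the \<open>M j\<close>, from left to right in the order of the index list.\<close>

definition mat_prod :: "nat \<Rightarrow> (nat \<Rightarrow> complex mat) \<Rightarrow> nat list \<Rightarrow> complex mat" where
  "mat_prod n M js = foldr (\<lambda>j P. M j * P) js (1\<^sub>m n)"

abbreviation prod_up :: "nat \<Rightarrow> (nat \<Rightarrow> complex mat) \<Rightarrow> nat \<Rightarrow> nat \<Rightarrow> complex mat" where
  "prod_up n M a b \<equiv> mat_prod n M [a..<Suc b]"

abbreviation prod_down :: "nat \<Rightarrow> (nat \<Rightarrow> complex mat) \<Rightarrow> nat \<Rightarrow> nat \<Rightarrow> complex mat" where
  "prod_down n M b a \<equiv> mat_prod n M (rev [a..<Suc b])"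

text \<open>The expansion \<open>F(z) = z^q (z^(-1) B 1 + \<dots> + z^(-n) B n)\<close>; the \<open>B j\<close> may vanish.\<close>

definition fir_expansion ::
  "nat \<Rightarrow> nat \<Rightarrow> int \<Rightarrow> nat \<Rightarrow> (nat \<Rightarrow> complex mat) \<Rightarrow> (complex \<Rightarrow> complex mat) \<Rightarrow> bool" where
  "fir_expansion p m q n B F \<longleftrightarrow>
     (\<forall>j\<in>{1..n}. B j \<in> carrier_mat p m) \<and>
     (\<forall>z. z \<noteq> 0 \<longrightarrow>
        F z = mat p m (\<lambda>(i, k). z powi q * (\<Sum>j=1..n. z powi (- int j) * B j $$ (i, k))))"

definition fir :: "nat \<Rightarrow> nat \<Rightarrow> (complex \<Rightarrow> complex mat) \<Rightarrow> bool" where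
  "fir p m F \<longleftrightarrow> (\<exists>q n B. fir_expansion p m q n B F)"

definition causal :: "nat \<Rightarrow> nat \<Rightarrow> (complex \<Rightarrow> complex mat) \<Rightarrow> bool" where
  "causal p m F \<longleftrightarrow> (\<exists>q n B. fir_expansion p m q n B F \<and> q \<le> 1)"

definition anticausal :: "nat \<Rightarrow> nat \<Rightarrow> (complex \<Rightarrow> complex mat) \<Rightarrow> bool" where
  "anticausal p m F \<longleftrightarrow> (\<exists>q n B. fir_expansion p m q n B F \<and> q \<ge> int n)"

text \<open>Only strictly negative, respectively strictly positive, powers occur.\<close>

definition strictly_causal :: "nat \<Rightarrow> nat \<Rightarrow> (complex \<Rightarrow> complex mat) \<Rightarrow> bool" where
  "strictly_causal p m F \<longleftrightarrow> (\<exists>q n B. fir_expansion p m q n B F \<and> q \<le> 0)"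

definition strictly_anticausal :: "nat \<Rightarrow> nat \<Rightarrow> (complex \<Rightarrow> complex mat) \<Rightarrow> bool" where
  "strictly_anticausal p m F \<longleftrightarrow> (\<exists>q n B. fir_expansion p m q n B F \<and> q > int n)"

text \<open>
  Equality of rational functions is equality off a finite set.  At the finitely many
  eigenvalues of \<open>A\<close>, and at the poles of \<open>G\<close>, the values compared are meaningless.
\<close>

definition realization ::
  "nat \<Rightarrow> nat \<Rightarrow> nat \<Rightarrow> (complex \<Rightarrow> complex mat) \<Rightarrow>
   complex mat \<Rightarrow> complex mat \<Rightarrow> complex mat \<Rightarrow> complex mat \<Rightarrow> bool" where
  "realization p m \<nu> G A B C D \<longleftrightarrow>
     A \<in> carrier_mat \<nu> \<nu> \<and> B \<in> carrier_mat \<nu> m \<and> C \<in> carrier_mat p \<nu> \<and> D \<in> carrier_mat p m \<and>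
     (\<forall>\<^sub>F z in cofinite. G z = C * mat_inv (z \<cdot>\<^sub>m 1\<^sub>m \<nu> - A) * B + D)"

text \<open>The McMillan degree of a rational function without pole at infinity.\<close>

definition proper_mcmillan_degree :: "nat \<Rightarrow> nat \<Rightarrow> (complex \<Rightarrow> complex mat) \<Rightarrow> nat" where
  "proper_mcmillan_degree p m G = (LEAST \<nu>. \<exists>A B C D. realization p m \<nu> G A B C D)"

text \<open>
  The McMillan degree of a Laurent polynomial.  The three summands exist and are determined
  by \<open>F\<close> (at \<open>z \<noteq> 0\<close>), so this relation holds for exactly one \<open>d\<close>.
\<close>

definition has_mcmillan_degree :: "nat \<Rightarrow> nat \<Rightarrow> (complex \<Rightarrow> complex mat) \<Rightarrow> nat \<Rightarrow> bool" where
  "has_mcmillan_degree p m F d \<longleftrightarrow>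
     (\<exists>Fl D Fr. strictly_anticausal p m Fl \<and> D \<in> carrier_mat p m \<and> strictly_causal p m Fr \<and>
        (\<forall>z. z \<noteq> 0 \<longrightarrow> F z = Fl z + D + Fr z) \<and>
        d = proper_mcmillan_degree p m Fr + proper_mcmillan_degree p m (\<lambda>z. Fl (1 / z)))"

text \<open>
  Rational functions with a common denominator \<open>Q\<close> of the entries.  \<open>Q\<close> has no zero on the unit
  circle, so that the values of \<open>F\<close> there are those of the rational function.  This loses
  nothing for the class \<open>U\<close>: a function that is (co-)isometric on the circle is bounded there
  and hence has no pole on it.
\<close>

definition rational_on_circle :: "nat \<Rightarrow> nat \<Rightarrow> (complex \<Rightarrow> complex mat) \<Rightarrow> bool" where
  "rational_on_circle p m F \<longleftrightarrow>
     (\<exists>(N :: nat \<Rightarrow> nat \<Rightarrow> complex poly) Q.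
        (\<forall>z. cmod z = 1 \<longrightarrow> poly Q z \<noteq> 0) \<and>
        (\<forall>z. poly Q z \<noteq> 0 \<longrightarrow> F z = mat p m (\<lambda>(i, k). poly (N i k) z / poly Q z)))"

definition isometrically_in_U :: "nat \<Rightarrow> nat \<Rightarrow> (complex \<Rightarrow> complex mat) \<Rightarrow> bool" where
  "isometrically_in_U p m F \<longleftrightarrow>
     m \<le> p \<and> rational_on_circle p m F \<and> (\<forall>z. cmod z = 1 \<longrightarrow> mat_adjoint (F z) * F z = 1\<^sub>m m)"

definition coisometrically_in_U :: "nat \<Rightarrow> nat \<Rightarrow> (complex \<Rightarrow> complex mat) \<Rightarrow> bool" where
  "coisometrically_in_U p m F \<longleftrightarrow>
     p \<le> m \<and> rational_on_circle p m F \<and> (\<forall>z. cmod z = 1 \<longrightarrow> F z * mat_adjoint (F z) = 1\<^sub>m p)"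

text \<open>The matrix \<open>I + (w - 1) v v\<^sup>*\<close> of size \<open>n\<close>, used with \<open>w = z\<close> and \<open>w = 1/z\<close>.\<close>

definition elem_factor :: "nat \<Rightarrow> complex \<Rightarrow> complex vec \<Rightarrow> complex mat" where
  "elem_factor n w v = 1\<^sub>m n + (w - 1) \<cdot>\<^sub>m mat n n (\<lambda>(i, k). v $ i * cnj (v $ k))"

definition unit_vectors :: "nat \<Rightarrow> nat \<Rightarrow> (nat \<Rightarrow> complex vec) \<Rightarrow> bool" where
  "unit_vectors n d v \<longleftrightarrow> (\<forall>j\<in>{1..d}. v j \<in> carrier_vec n \<and> conjugate (v j) \<bullet> v j = 1)"

definition iso_data ::
  "nat \<Rightarrow> nat \<Rightarrow> nat \<Rightarrow> nat \<Rightarrow> (nat \<Rightarrow> complex vec) \<Rightarrow> complex mat \<Rightarrow> bool" where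
  "iso_data p m d \<gamma> v U \<longleftrightarrow>
     \<gamma> \<le> d \<and> unit_vectors p d v \<and> U \<in> carrier_mat p m \<and> mat_adjoint U * U = 1\<^sub>m m"

definition coiso_data ::
  "nat \<Rightarrow> nat \<Rightarrow> nat \<Rightarrow> nat \<Rightarrow> (nat \<Rightarrow> complex vec) \<Rightarrow> complex mat \<Rightarrow> bool" where
  "coiso_data p m d \<gamma> v U \<longleftrightarrow>
     \<gamma> \<le> d \<and> unit_vectors m d v \<and> U \<in> carrier_mat p m \<and> U * mat_adjoint U = 1\<^sub>m p"

definition iso_form1 ::
  "nat \<Rightarrow> nat \<Rightarrow> nat \<Rightarrow> (nat \<Rightarrow> complex vec) \<Rightarrow> complex mat \<Rightarrow> complex \<Rightarrow> complex mat" where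
  "iso_form1 p d \<gamma> v U z =
     prod_up p (\<lambda>j. elem_factor p z (v j)) 1 \<gamma> *
     prod_up p (\<lambda>j. elem_factor p (1 / z) (v j)) (\<gamma> + 1) d * U"

definition iso_form2 ::
  "nat \<Rightarrow> nat \<Rightarrow> nat \<Rightarrow> (nat \<Rightarrow> complex vec) \<Rightarrow> complex mat \<Rightarrow> complex \<Rightarrow> complex mat" where
  "iso_form2 p d \<gamma> v U z =
     prod_up p (\<lambda>j. elem_factor p z (v j)) 1 \<gamma> *
     mat_inv (prod_down p (\<lambda>j. elem_factor p z (v j)) d (\<gamma> + 1)) * U"

definition iso_form3 ::
  "nat \<Rightarrow> nat \<Rightarrow> nat \<Rightarrow> (nat \<Rightarrow> complex vec) \<Rightarrow> complex mat \<Rightarrow> complex \<Rightarrow> complex mat" where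
  "iso_form3 p d \<gamma> v U z =
     mat_inv (prod_down p (\<lambda>j. elem_factor p (1 / z) (v j)) \<gamma> 1) *
     prod_up p (\<lambda>j. elem_factor p (1 / z) (v j)) (\<gamma> + 1) d * U"

definition coiso_form1 ::
  "nat \<Rightarrow> nat \<Rightarrow> nat \<Rightarrow> (nat \<Rightarrow> complex vec) \<Rightarrow> complex mat \<Rightarrow> complex \<Rightarrow> complex mat" where
  "coiso_form1 m d \<gamma> v U z =
     U * prod_up m (\<lambda>j. elem_factor m (1 / z) (v j)) (\<gamma> + 1) d *
     prod_up m (\<lambda>j. elem_factor m z (v j)) 1 \<gamma>"

definition coiso_form2 ::
  "nat \<Rightarrow> nat \<Rightarrow> nat \<Rightarrow> (nat \<Rightarrow> complex vec) \<Rightarrow> complex mat \<Rightarrow> complex \<Rightarrow> complex mat" where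
  "coiso_form2 m d \<gamma> v U z =
     U * mat_inv (prod_down m (\<lambda>j. elem_factor m z (v j)) d (\<gamma> + 1)) *
     prod_up m (\<lambda>j. elem_factor m z (v j)) 1 \<gamma>"

definition coiso_form3 ::
  "nat \<Rightarrow> nat \<Rightarrow> nat \<Rightarrow> (nat \<Rightarrow> complex vec) \<Rightarrow> complex mat \<Rightarrow> complex \<Rightarrow> complex mat" where
  "coiso_form3 m d \<gamma> v U z =
     U * prod_up m (\<lambda>j. elem_factor m (1 / z) (v j)) (\<gamma> + 1) d *
     mat_inv (prod_down m (\<lambda>j. elem_factor m (1 / z) (v j)) \<gamma> 1)"

text \<open>Equality as Laurent polynomials.\<close>

definition eq_laurent :: "(complex \<Rightarrow> complex mat) \<Rightarrow> (complex \<Rightarrow> complex mat) \<Rightarrow> bool" where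
  "eq_laurent F G \<longleftrightarrow> (\<forall>z. z \<noteq> 0 \<longrightarrow> F z = G z)"

end

theory Submission
  imports Defs "HOL-Library.Function_Algebras"
begin

text \<open>
  The McMillan degree is a Hankel rank.  Write \<open>F(z) = \<Sum> f\<^sub>k z^k\<close>.  The columns
  \<open>(f\<^sub>n\<^sub>+\<^sub>1 e\<^sub>j, f\<^sub>n\<^sub>+\<^sub>2 e\<^sub>j, \<dots>)\<close>, for \<open>n \<ge> 0\<close>, span a finite-dimensional shift-invariant space of
  sequences; it consists of the analytic parts \<open>P\<^sub>+(F u)\<close>, where \<open>u\<close> is a vector polynomial in
  \<open>1/z\<close> without constant term.  Its dimension is the least size of a realization of the strictly causal
  function \<open>\<Sum>\<^sub>k\<^sub>>\<^sub>0 f\<^sub>k z^(-k)\<close> (\<open>proper_mcmillan_degree_eq_hankel_rank\<close>).  Hence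
  \<open>d = r\<^sub>- + r\<^sub>+\<close>, where \<open>r\<^sub>+\<close> is the Hankel rank of \<open>f\<close> and \<open>r\<^sub>-\<close> that of the coefficients of
  \<open>F(1/z)\<close>.

  Let \<open>F\<close> be isometric on the circle with \<open>r\<^sub>+ > 0\<close>.  By shift invariance the Hankel range
  contains a constant unit vector \<open>v = P\<^sub>+(F w)\<close>, with \<open>w\<close> of this kind.  Put
  \<open>V(z) = I + (1/z - 1) v v\<^sup>*\<close>, so that \<open>F = V\<^sup>-\<^sup>1 (V F)\<close> with \<open>V\<^sup>-\<^sup>1 = I + (z - 1) v v\<^sup>*\<close>.
  The Hankel range of \<open>V F\<close> is the image of that of \<open>F\<close> under \<open>P\<^sub>+ V\<close>, whose kernel is the line
  of \<open>v\<close>; thus \<open>r\<^sub>+\<close> drops by exactly one (\<open>hankel_rank_factored_coeffs\<close>).  On the other side,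
  \<open>V\<close> could create a new term \<open>z^(-1) v (v\<^sup>* g\<^sub>0)\<close> out of an analytic \<open>g = F u\<close>, with \<open>u\<close>
  analytic.  But \<open>v\<^sup>* g\<^sub>0 = \<langle>F w, F u\<rangle> = \<langle>w, u\<rangle> = 0\<close>, because \<open>F\<close> is isometric; thus \<open>r\<^sub>-\<close> does
  not change (\<open>hankel_rank_reflect_factored_coeffs\<close>).  Of the two rank statements only the second
  uses isometry, and neither needs \<open>F\<close> to be square.

  After \<open>r\<^sub>+\<close> steps a function with \<open>r\<^sub>+ = 0\<close> remains.  The same procedure, applied to its
  reflection \<open>z \<mapsto> 1/z\<close>, splits off \<open>r\<^sub>-\<close> factors and keeps the other rank at \<open>0\<close>.  What is left
  is a constant isometry, and \<open>\<gamma> = r\<^sub>+\<close> (\<open>isometric_factorization\<close>).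

  The converse holds because every elementary factor is unitary on the circle.  The three forms
  agree because \<open>I + (z - 1) v v\<^sup>*\<close> and \<open>I + (1/z - 1) v v\<^sup>*\<close> are inverse to each other.  The
  co-isometric case follows by transposition, which preserves the McMillan degree.
\<close>

section \<open>Linear algebra of coefficient sequences\<close>

text \<open>
  Doubly indexed families form a complex vector space with pointwise operations.  The first index
  is an exponent and the second a row of the matrix.
\<close>

definition fscale ::
  "complex \<Rightarrow> ('a \<Rightarrow> 'b \<Rightarrow> complex) \<Rightarrow> 'a \<Rightarrow> 'b \<Rightarrow> complex" where
  "fscale c g = (\<lambda>a b. c * g a b)"

interpretation FS: vector_space "fscale :: complex \<Rightarrow> ('a \<Rightarrow> 'b \<Rightarrow> complex) \<Rightarrow> 'a \<Rightarrow> 'b \<Rightarrow> complex"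
  by unfold_locales (auto simp: fscale_def fun_eq_iff algebra_simps)

interpretation FSP: vector_space_pair
  "fscale :: complex \<Rightarrow> ('a \<Rightarrow> 'b \<Rightarrow> complex) \<Rightarrow> 'a \<Rightarrow> 'b \<Rightarrow> complex"
  "fscale :: complex \<Rightarrow> ('c \<Rightarrow> 'd \<Rightarrow> complex) \<Rightarrow> 'c \<Rightarrow> 'd \<Rightarrow> complex"
  by unfold_locales

abbreviation flinear :: "(('a \<Rightarrow> 'b \<Rightarrow> complex) \<Rightarrow> ('c \<Rightarrow> 'd \<Rightarrow> complex)) \<Rightarrow> bool" where
  "flinear T \<equiv> Vector_Spaces.linear fscale fscale T"

lemma flinearI:
  assumes "\<And>x y. T (x + y) = T x + T y" "\<And>c x. T (fscale c x) = fscale c (T x)"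
  shows "flinear T"
  unfolding Vector_Spaces.linear_iff by (intro conjI allI assms FS.vector_space_axioms)

lemma dim_image_inj:
  assumes T: "flinear T" and V: "FS.subspace V"
    and ker: "\<And>x. x \<in> V \<Longrightarrow> T x = 0 \<Longrightarrow> x = 0"
  shows "FS.dim (T ` V) = FS.dim V"
proof -
  obtain B where B: "B \<subseteq> V" "FS.independent B" "V \<subseteq> FS.span B" "card B = FS.dim V"
    by (rule FS.basis_exists)
  have sp: "FS.span B = V"
    using B V by (simp add: FS.span_minimal subset_antisym)
  have inj: "inj_on T (FS.span B)"
    unfolding sp FSP.linear_inj_on_iff_eq_0[OF T V] using ker by blast
  have "FS.independent (T ` B)"
    by (rule FSP.linear_independent_injective_image[OF T B(2) inj])
  moreover have "FS.span (T ` B) = T ` V"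
    by (simp add: FSP.linear_span_image[OF T] sp)
  ultimately have "FS.dim (T ` V) = card (T ` B)"
    by (metis FS.dim_span_eq_card_independent)
  also have "\<dots> = card B"
    by (rule card_image) (meson FS.span_superset inj inj_on_subset)
  finally show ?thesis using B(4) by simp
qed

text \<open>Rank and nullity for a map whose kernel in \<open>V\<close> is the line of \<open>x0\<close>.\<close>

lemma dim_image_kernel_line:
  assumes T: "flinear T" and V: "FS.subspace V" and W: "finite W" "V \<subseteq> FS.span W"
    and x0: "x0 \<in> V" "x0 \<noteq> 0" "T x0 = 0"
    and ker: "\<And>x. x \<in> V \<Longrightarrow> T x = 0 \<Longrightarrow> \<exists>c. x = fscale c x0"
  shows "FS.dim V = Suc (FS.dim (T ` V))"
proof -
  have "FS.independent {x0}"
    using x0 by simp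
  then obtain B where B: "{x0} \<subseteq> B" "B \<subseteq> V" "FS.independent B" "V \<subseteq> FS.span B"
    using FS.maximal_independent_subset_extend[of "{x0}" V] x0 by auto
  have fin: "finite B"
    using FS.independent_span_bound[OF W(1) B(3)] B(2) W(2) by blast
  define B0 where "B0 = B - {x0}"
  have BB: "B = insert x0 B0" and nB: "x0 \<notin> B0"
    using B(1) by (auto simp: B0_def)
  have ind0: "FS.independent B0" and nsp: "x0 \<notin> FS.span B0"
    using B(3) nB unfolding BB FS.independent_insert by auto
  have sp: "FS.span B = V"
    using B V by (simp add: FS.span_minimal subset_antisym)
  have sub0: "FS.span B0 \<subseteq> V"
    unfolding sp[symmetric] BB by (rule FS.span_mono) auto
  have inj: "inj_on T (FS.span B0)"
    unfolding FSP.linear_inj_on_iff_eq_0[OF T FS.subspace_span]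
  proof safe
    fix x assume x: "x \<in> FS.span B0" "T x = 0"
    then obtain c where c: "x = fscale c x0"
      using ker sub0 by blast
    have "c = 0"
    proof (rule ccontr)
      assume "c \<noteq> 0"
      then have "x0 = fscale (1 / c) x"
        using c by simp
      then show False
        using FS.span_scale[OF x(1)] nsp by metis
    qed
    then show "x = 0" using c by simp
  qed
  have "FS.independent (T ` B0)"
    by (rule FSP.linear_independent_injective_image[OF T ind0 inj])
  moreover have "FS.span (T ` B0) = T ` V"
  proof -
    have "T ` V = FS.span (T ` B)"
      by (simp add: FSP.linear_span_image[OF T] sp)
    also have "T ` B = insert 0 (T ` B0)"
      using x0 BB by auto
    finally show ?thesis by simp
  qed
  ultimately have "FS.dim (T ` V) = card (T ` B0)"
    by (metis FS.dim_span_eq_card_independent)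
  also have "\<dots> = card B0"
    by (rule card_image) (meson FS.span_superset inj inj_on_subset)
  finally show ?thesis
    using FS.dim_span_eq_card_independent[OF B(3)] fin nB unfolding sp by (simp add: BB)
qed

section \<open>Hankel range and Hankel rank\<close>

text \<open>
  Coefficients of a matrix Laurent polynomial are a function \<open>f k i j\<close> of the exponent \<open>k\<close>, the
  row \<open>i\<close> and the column \<open>j\<close>.  A column of the infinite block Hankel matrix of the positive
  part has the blocks \<open>f (n + 1), f (n + 2), \<dots>\<close>, each restricted to its column \<open>j\<close>.
\<close>

definition hankel_col ::
  "(int \<Rightarrow> nat \<Rightarrow> nat \<Rightarrow> complex) \<Rightarrow> nat \<Rightarrow> nat \<Rightarrow> nat \<Rightarrow> nat \<Rightarrow> complex" where
  "hankel_col f n j = (\<lambda>k i. f (1 + int n + int k) i j)"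

text \<open>The column space of the Hankel matrix of the coefficients with positive index.\<close>

definition hankel_range ::
  "(int \<Rightarrow> nat \<Rightarrow> nat \<Rightarrow> complex) \<Rightarrow> (nat \<Rightarrow> nat \<Rightarrow> complex) set" where
  "hankel_range f = FS.span ({hankel_col f n j | n j. True})"

definition hankel_rank ::
  "(int \<Rightarrow> nat \<Rightarrow> nat \<Rightarrow> complex) \<Rightarrow> nat" where
  "hankel_rank f = FS.dim (hankel_range f)"

text \<open>The coefficients of a \<open>p \<times> m\<close> Laurent polynomial with exponents between \<open>-N\<close> and \<open>N\<close>.\<close>

definition laurent_coeffs ::
  "nat \<Rightarrow> nat \<Rightarrow> nat \<Rightarrow> (int \<Rightarrow> nat \<Rightarrow> nat \<Rightarrow> complex) \<Rightarrow> bool" where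
  "laurent_coeffs p m N f \<longleftrightarrow> (\<forall>k i j. f k i j \<noteq> 0 \<longrightarrow> \<bar>k\<bar> \<le> int N \<and> i < p \<and> j < m)"

text \<open>The coefficients of \<open>F(1/z)\<close>.\<close>

definition reflect ::
  "(int \<Rightarrow> nat \<Rightarrow> nat \<Rightarrow> complex) \<Rightarrow> int \<Rightarrow> nat \<Rightarrow> nat \<Rightarrow> complex" where
  "reflect f = (\<lambda>k. f (- k))"

lemma laurent_coeffsD: "laurent_coeffs p m N f \<Longrightarrow> int N < \<bar>k\<bar> \<or> p \<le> i \<or> m \<le> j \<Longrightarrow> f k i j = 0"
  unfolding laurent_coeffs_def by (meson leD)

lemma reflect_reflect [simp]: "reflect (reflect f) = f"
  by (simp add: reflect_def)

lemma laurent_coeffs_reflect: "laurent_coeffs p m N f \<Longrightarrow> laurent_coeffs p m N (reflect f)"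
  unfolding laurent_coeffs_def reflect_def by (metis abs_minus)

lemma subspace_hankel_range [simp]: "FS.subspace (hankel_range f)"
  by (simp add: hankel_range_def)

lemma hankel_col_in_range [simp]: "hankel_col f n j \<in> hankel_range f"
  unfolding hankel_range_def by (rule FS.span_base) auto

text \<open>Induction over linear combinations that remembers membership in the Hankel range.\<close>

lemma hankel_range_induct [consumes 1, case_names zero step]:
  assumes "g \<in> hankel_range f" "P 0"
    "\<And>c n j g. g \<in> hankel_range f \<Longrightarrow> P g \<Longrightarrow> P (fscale c (hankel_col f n j) + g)"
  shows "P g"
proof -
  have "g \<in> hankel_range f \<and> P g"
    using assms(1) unfolding hankel_range_def
  proof (induction (no_simp) rule: FS.span_induct_alt)
    case base then show ?case using assms(2) FS.span_zero by blast
  next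
    case (step c x y)
    from step(1) obtain n j where x: "x = hankel_col f n j" by blast
    have "fscale c x + y \<in> FS.span {hankel_col f n j | n j. True} \<and> P (fscale c x + y)"
    proof
      show "fscale c x + y \<in> FS.span {hankel_col f n j | n j. True}"
        by (rule FS.span_add[OF FS.span_scale[OF FS.span_base[OF step(1)]]]) (use step in blast)
      show "P (fscale c x + y)"
        unfolding x using step(2) by (intro assms(3)) (auto simp: hankel_range_def)
    qed
    then show ?case by (simp add: plus_fun_def)
  qed
  then show ?thesis by simp
qed

lemma hankel_range_support:
  assumes "laurent_coeffs p m N f" "g \<in> hankel_range f" "N \<le> k \<or> p \<le> i"
  shows "g k i = 0"
  using assms(2)
proof (induction (no_simp) rule: hankel_range_induct)
  case (step c n j g)
  have "hankel_col f n j k i = 0"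
    unfolding hankel_col_def using assms(3) by (intro laurent_coeffsD[OF assms(1)]) auto
  then show ?case using step by (simp add: fscale_def)
qed simp

lemma hankel_range_finite_span:
  assumes "laurent_coeffs p m N f"
  shows "hankel_range f \<subseteq> FS.span ((\<lambda>(n, j). hankel_col f n j) ` ({..<N} \<times> {..<m}))"
  unfolding hankel_range_def
proof (rule FS.span_minimal)
  show "{hankel_col f n j | n j. True} \<subseteq> FS.span ((\<lambda>(n, j). hankel_col f n j) ` ({..<N} \<times> {..<m}))"
  proof clarify
    fix n j
    show "hankel_col f n j \<in> FS.span ((\<lambda>(n, j). hankel_col f n j) ` ({..<N} \<times> {..<m}))"
    proof (cases "n < N \<and> j < m")
      case True
      then show ?thesis by (intro FS.span_base) force
    next
      case False
      then have "hankel_col f n j = 0"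
        unfolding hankel_col_def by (intro ext, subst laurent_coeffsD[OF assms]) auto
      then show ?thesis by (simp add: FS.span_zero)
    qed
  qed
qed simp

text \<open>The backward shift; it leaves the Hankel range invariant.\<close>

definition shift ::
  "(nat \<Rightarrow> nat \<Rightarrow> complex) \<Rightarrow> nat \<Rightarrow> nat \<Rightarrow> complex" where
  "shift g = (\<lambda>k. g (Suc k))"

lemma flinear_shift: "flinear shift"
  by (rule flinearI) (auto simp: shift_def fscale_def fun_eq_iff)

lemma shift_hankel_col: "shift (hankel_col f n j) = hankel_col f (Suc n) j"
  by (simp add: shift_def hankel_col_def algebra_simps)

lemma shift_hankel_range: "g \<in> hankel_range f \<Longrightarrow> shift g \<in> hankel_range f"
proof (induction (no_simp) rule: hankel_range_induct)
  case zero
  then show ?case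
    using FSP.linear_0[OF flinear_shift] FS.subspace_0[OF subspace_hankel_range] by metis
next
  case (step c n j g)
  show ?case
    unfolding FSP.linear_add[OF flinear_shift] FSP.linear_scale[OF flinear_shift] shift_hankel_col
    by (intro FS.subspace_add FS.subspace_scale subspace_hankel_range hankel_col_in_range step(2))
qed

lemma shift_iterate_hankel_range: "g \<in> hankel_range f \<Longrightarrow> (\<lambda>k. g (n + k)) \<in> hankel_range f"
proof (induction n)
  case (Suc n)
  then show ?case
    using shift_hankel_range[of "\<lambda>k. g (n + k)" f] by (simp add: shift_def)
qed simp

text \<open>The vector \<open>v\<close> as a constant, that is, in the block of index \<open>0\<close>.\<close>

definition const_seq ::
  "(nat \<Rightarrow> complex) \<Rightarrow> nat \<Rightarrow> nat \<Rightarrow> complex" where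
  "const_seq v = (\<lambda>k i. if k = 0 then v i else 0)"

text \<open>The product \<open>v\<^sup>* x\<close> of vectors of length \<open>p\<close>; conjugate-linear in the first argument.\<close>

definition cinner ::
  "nat \<Rightarrow> (nat \<Rightarrow> complex) \<Rightarrow> (nat \<Rightarrow> complex) \<Rightarrow> complex" where
  "cinner p v x = (\<Sum>i<p. cnj (v i) * x i)"

lemma cinner_add: "cinner p v (x + y) = cinner p v x + cinner p v y"
  and cinner_scale: "cinner p v (\<lambda>i. c * x i) = c * cinner p v x"
  and cinner_diff: "cinner p v (x - y) = cinner p v x - cinner p v y"
  and cinner_zero: "cinner p v 0 = 0"
  and cinner_zero': "cinner p v (\<lambda>i. 0) = 0"
  and cinner_add': "cinner p v (\<lambda>i. x i + y i) = cinner p v x + cinner p v y"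
  and cinner_diff': "cinner p v (\<lambda>i. x i - y i) = cinner p v x - cinner p v y"
  and cinner_scale2: "cinner p v (\<lambda>i. x i * c) = c * cinner p v x"
  by (simp_all add: cinner_def algebra_simps sum.distrib sum_distrib_left sum_subtractf)

lemma cinner_self: "cinner p v v = of_real (\<Sum>i<p. (cmod (v i))\<^sup>2)"
  unfolding cinner_def of_real_sum complex_norm_square by (simp add: mult.commute)

text \<open>
  Shifting a nonzero element until only its last nonzero block is left produces a constant.
\<close>

lemma exists_unit_const_in_hankel_range:
  assumes f: "laurent_coeffs p m N f" and pos: "hankel_rank f \<noteq> 0"
  obtains v where "const_seq v \<in> hankel_range f" "cinner p v v = 1" "\<And>i. p \<le> i \<Longrightarrow> v i = 0"
proof -
  have "\<not> hankel_range f \<subseteq> {0}"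
  proof
    assume "hankel_range f \<subseteq> {0}"
    then have "FS.dim (hankel_range f) \<le> card ({} :: (nat \<Rightarrow> nat \<Rightarrow> complex) set)"
      by (intro FS.dim_le_card) auto
    then show False using pos by (simp add: hankel_rank_def)
  qed
  then obtain g where g: "g \<in> hankel_range f" "g \<noteq> 0" by blast
  then obtain k0 where k0: "g k0 \<noteq> 0"
    by (metis fun_eq_iff zero_fun_def)
  define K where "K = {k. g k \<noteq> 0}"
  have KN: "K \<subseteq> {..<N}"
  proof
    fix k assume "k \<in> K"
    then obtain i where "g k i \<noteq> 0" by (auto simp: K_def fun_eq_iff)
    then show "k \<in> {..<N}" using hankel_range_support[OF f g(1), of k i] by (auto simp: not_less[symmetric])
  qed
  have fin: "finite K" and ne: "K \<noteq> {}"
    using KN finite_subset k0 by (auto simp: K_def)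
  define n where "n = Max K"
  have n: "g n \<noteq> 0" "\<And>k. n < k \<Longrightarrow> g k = 0"
    using Max_in[OF fin ne] Max_ge[OF fin] unfolding n_def K_def by (auto dest: leD)
  define r where "r = sqrt (\<Sum>i<p. (cmod (g n i))\<^sup>2)"
  obtain i0 where i0: "g n i0 \<noteq> 0" using n(1) by (auto simp: fun_eq_iff)
  have i0p: "i0 < p"
    using hankel_range_support[OF f g(1), of n i0] i0 by (auto simp: not_less[symmetric])
  have s: "(\<Sum>i<p. (cmod (g n i))\<^sup>2) > 0"
    by (rule sum_pos2[of _ i0]) (use i0 i0p in auto)
  have r0: "r \<noteq> 0" and r2: "complex_of_real r * r = (\<Sum>i<p. (cmod (g n i))\<^sup>2)"
    using s by (auto simp: r_def simp flip: of_real_mult)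
  define v where "v = (\<lambda>i. g n i / r)"
  have "const_seq v = fscale (1 / r) (\<lambda>k. g (n + k))"
    using n(2) by (auto simp: const_seq_def v_def fscale_def fun_eq_iff)
  then have "const_seq v \<in> hankel_range f"
    using shift_iterate_hankel_range[OF g(1)] by (simp add: FS.subspace_scale)
  moreover have "cinner p v v = 1"
  proof -
    have "cinner p v v = cinner p (g n) (g n) / (complex_of_real r * r)"
      by (simp add: cinner_def v_def sum_divide_distrib)
    then show ?thesis using r0 by (simp only: cinner_self flip: r2) simp
  qed
  moreover have "v i = 0" if "p \<le> i" for i
    using hankel_range_support[OF f g(1), of n i] that by (simp add: v_def)
  ultimately show ?thesis using that by blast
qed

section \<open>Splitting off an elementary factor\<close>

text \<open>
  For an analytic \<open>g = \<Sum> g\<^sub>k z^k\<close> this is the analytic part of \<open>(I + (1/z - 1) v v\<^sup>*) g\<close>.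
\<close>

definition deflate ::
  "nat \<Rightarrow> (nat \<Rightarrow> complex) \<Rightarrow> (nat \<Rightarrow> nat \<Rightarrow> complex) \<Rightarrow> nat \<Rightarrow> nat \<Rightarrow> complex" where
  "deflate p v g = (\<lambda>k i. g k i - v i * cinner p v (g k) + v i * cinner p v (g (Suc k)))"

text \<open>The coefficients of \<open>(I + (1/z - 1) v v\<^sup>*) F(z)\<close>.\<close>

definition factored_coeffs ::
  "nat \<Rightarrow> (nat \<Rightarrow> complex) \<Rightarrow> (int \<Rightarrow> nat \<Rightarrow> nat \<Rightarrow> complex) \<Rightarrow> int \<Rightarrow> nat \<Rightarrow> nat \<Rightarrow> complex" where
  "factored_coeffs p v f = (\<lambda>k i j. f k i j - v i * cinner p v (\<lambda>l. f k l j) + v i * cinner p v (\<lambda>l. f (k + 1) l j))"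

lemma flinear_deflate: "flinear (deflate p v)"
  by (rule flinearI)
    (auto simp: deflate_def fscale_def fun_eq_iff cinner_add cinner_scale cinner_add' algebra_simps)

lemma deflate_const_seq: "cinner p v v = 1 \<Longrightarrow> deflate p v (const_seq v) = 0"
  by (auto simp: deflate_def const_seq_def fun_eq_iff cinner_zero')

text \<open>For a unit vector \<open>v\<close>, the kernel of \<^term>\<open>deflate p v\<close> lies in the line of the constant \<open>v\<close>.\<close>

lemma deflate_eq_0D:
  assumes v: "cinner p v v = 1" and g: "deflate p v g = 0"
  shows "g = fscale (cinner p v (g 0)) (const_seq v)"
proof -
  define a where "a k = cinner p v (g k)" for k
  have g1: "g k i = (a k - a (Suc k)) * v i" for k i
    using fun_cong[OF fun_cong[OF g, of k], of i] by (simp add: deflate_def a_def algebra_simps)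
  have "a k = a k - a (Suc k)" for k
  proof -
    have "g k = (\<lambda>i. (a k - a (Suc k)) * v i)" using g1 by blast
    then have "a k = cinner p v (\<lambda>i. (a k - a (Suc k)) * v i)" using a_def by metis
    then show ?thesis by (simp only: cinner_scale v mult_1_right)
  qed
  then have "a (Suc k) = 0" for k by (metis add_cancel_right_right diff_add_cancel)
  then have "g k i = (if k = 0 then a 0 * v i else 0)" for k i
    using g1[of k i] by (cases k) auto
  then show ?thesis by (auto simp: fun_eq_iff fscale_def const_seq_def a_def)
qed

lemma hankel_col_factored_coeffs: "hankel_col (factored_coeffs p v f) n j = deflate p v (hankel_col f n j)"
  by (simp add: hankel_col_def factored_coeffs_def deflate_def fun_eq_iff algebra_simps)

lemma image_hankel_range:
  assumes T: "flinear T" and h: "\<And>n j. T (h n j) = hankel_col f n j"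
  shows "T ` FS.span {h n j | n j. True} = hankel_range f"
proof -
  have "T ` {h n j | n j. True} = {hankel_col f n j | n j. True}"
    using h by (auto simp: image_iff) metis+
  then show ?thesis
    unfolding hankel_range_def by (simp add: FSP.linear_span_image[OF T, symmetric])
qed

lemma hankel_range_factored_coeffs: "hankel_range (factored_coeffs p v f) = deflate p v ` hankel_range f"
  unfolding hankel_range_def[of f]
  by (rule image_hankel_range[symmetric, OF flinear_deflate]) (simp add: hankel_col_factored_coeffs)

lemma hankel_rank_factored_coeffs:
  assumes f: "laurent_coeffs p m N f" and v: "cinner p v v = 1" "const_seq v \<in> hankel_range f"
  shows "hankel_rank f = Suc (hankel_rank (factored_coeffs p v f))"
  unfolding hankel_rank_def hankel_range_factored_coeffs
proof (rule dim_image_kernel_line[OF flinear_deflate])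
  show "hankel_range f \<subseteq> FS.span ((\<lambda>(n, j). hankel_col f n j) ` ({..<N} \<times> {..<m}))"
    by (rule hankel_range_finite_span[OF f])
  show "const_seq v \<noteq> 0"
  proof
    assume "const_seq v = 0"
    then have "v i = 0" for i by (auto simp: const_seq_def fun_eq_iff split: if_splits)
    then show False using v(1) by (simp add: cinner_def)
  qed
qed (use v deflate_eq_0D[OF v(1)] in \<open>auto simp: deflate_const_seq\<close>)

section \<open>The Hankel rank on the other side is unchanged\<close>

text \<open>
  The nonzero powers of \<open>z\<close> in \<open>F(z)\<^sup>* F(z)\<close>, for \<open>|z| = 1\<close>, have coefficient zero.
\<close>

definition coeffs_orthogonal ::
  "nat \<Rightarrow> nat \<Rightarrow> (int \<Rightarrow> nat \<Rightarrow> nat \<Rightarrow> complex) \<Rightarrow> bool" where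
  "coeffs_orthogonal p N f \<longleftrightarrow> (\<forall>s j l. s \<noteq> 0 \<longrightarrow>
     (\<Sum>k\<in>{- int N..int N}. cinner p (\<lambda>i. f k i j) (\<lambda>i. f (k + s) i l)) = 0)"

text \<open>The coefficients of \<open>z^n F(z) e\<^sub>j\<close>.\<close>

definition laurent_col ::
  "(int \<Rightarrow> nat \<Rightarrow> nat \<Rightarrow> complex) \<Rightarrow> int \<Rightarrow> nat \<Rightarrow> int \<Rightarrow> nat \<Rightarrow> complex" where
  "laurent_col f n j = (\<lambda>k i. f (k - n) i j)"

lemma laurent_col_orthogonal:
  assumes f: "laurent_coeffs p m N f" "coeffs_orthogonal p N f" and ne: "n \<noteq> n'"
  shows "\<forall>\<^sub>F M in sequentially. (\<Sum>k\<in>{- int M..int M}. cinner p (laurent_col f n' j k) (laurent_col f n l k)) = 0"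
  unfolding eventually_sequentially
proof (intro exI allI impI)
  fix M assume M: "N + nat \<bar>n'\<bar> \<le> M"
  have z: "cinner p (laurent_col f n' j k) (laurent_col f n l k) = 0" if "k \<notin> {n' - int N..n' + int N}" for k
    unfolding cinner_def laurent_col_def by (rule sum.neutral) (use that laurent_coeffsD[OF f(1), of "k - n'"] in auto)
  have "(\<Sum>k\<in>{- int M..int M}. cinner p (laurent_col f n' j k) (laurent_col f n l k))
      = (\<Sum>k\<in>{n' - int N..n' + int N}. cinner p (laurent_col f n' j k) (laurent_col f n l k))"
    by (rule sum.mono_neutral_right) (use M z in auto)
  also have "\<dots> = (\<Sum>k\<in>{- int N..int N}. cinner p (\<lambda>i. f k i j) (\<lambda>i. f (k + (n' - n)) i l))"
    by (rule sum.reindex_bij_witness[of _ "\<lambda>k. k + n'" "\<lambda>k. k - n'"]) (auto simp: laurent_col_def algebra_simps)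
  also have "\<dots> = 0" using f(2) ne by (simp add: coeffs_orthogonal_def)
  finally show "(\<Sum>k\<in>{- int M..int M}. cinner p (laurent_col f n' j k) (laurent_col f n l k)) = 0" .
qed

lemma cinner_lin_left: "cinner p (fscale c y k + z) x = cnj c * cinner p (y k) x + cinner p z x"
  and cinner_lin_right: "cinner p x (fscale c y k + z) = c * cinner p x (y k) + cinner p x z"
  by (simp_all add: cinner_def fscale_def algebra_simps sum.distrib sum_distrib_left)

text \<open>
  The spaces \<open>F u\<close> with \<open>u\<close> analytic and \<open>F w\<close> with \<open>w\<close> strictly negative are orthogonal.  The
  elements of the spans have finite support, but no common bound on it; hence the inner product is
  taken over all sufficiently large windows.
\<close>

lemma span_orthogonal:
  assumes f: "laurent_coeffs p m N f" "coeffs_orthogonal p N f"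
    and x: "x \<in> FS.span {laurent_col f (int n) j | n j. True}"
    and y: "y \<in> FS.span {laurent_col f (- 1 - int n) j | n j. True}"
  shows "\<forall>\<^sub>F M in sequentially. (\<Sum>k\<in>{- int M..int M}. cinner p (y k) (x k)) = 0"
  using x
proof (induction (no_simp) rule: FS.span_induct_alt)
  case base
  then show ?case by (simp add: cinner_zero cinner_zero')
next
  case (step c a b)
  obtain n j where a: "a = laurent_col f (int n) j" using step(1) by blast
  have "\<forall>\<^sub>F M in sequentially. (\<Sum>k\<in>{- int M..int M}. cinner p (y k) (a k)) = 0"
    using y
  proof (induction (no_simp) rule: FS.span_induct_alt)
    case base
    then show ?case by (simp add: cinner_def)
  next
    case (step c' a' b')
    obtain n' j' where a': "a' = laurent_col f (- 1 - int n') j'" using step(1) by blast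
    have "\<forall>\<^sub>F M in sequentially. (\<Sum>k\<in>{- int M..int M}. cinner p (a' k) (a k)) = 0"
      unfolding a a' by (rule laurent_col_orthogonal[OF f]) simp
    with step(2) have "\<forall>\<^sub>F M in sequentially. (\<Sum>k\<in>{- int M..int M}. cinner p ((fscale c' a' + b') k) (a k)) = 0"
      by eventually_elim (simp add: cinner_lin_left sum.distrib flip: sum_distrib_left)
    then show ?case by (simp only: plus_fun_def)
  qed
  with step(2) have "\<forall>\<^sub>F M in sequentially. (\<Sum>k\<in>{- int M..int M}. cinner p (y k) ((fscale c a + b) k)) = 0"
    by eventually_elim (simp add: cinner_lin_right sum.distrib flip: sum_distrib_left)
  then show ?case by (simp only: plus_fun_def)
qed

text \<open>
  The strictly negative part of \<open>(I + (1/z - 1) v v\<^sup>*) x\<close>, indexed by \<open>-1, -2, \<dots>\<close>.  Every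
  element of the reflected Hankel range of the new function is of this form.
\<close>

definition neg_part_factored ::
  "nat \<Rightarrow> (nat \<Rightarrow> complex) \<Rightarrow> (int \<Rightarrow> nat \<Rightarrow> complex) \<Rightarrow> nat \<Rightarrow> nat \<Rightarrow> complex" where
  "neg_part_factored p v x = (\<lambda>k i. x (- 1 - int k) i - v i * cinner p v (x (- 1 - int k)) + v i * cinner p v (x (- int k)))"

lemma flinear_neg_part_factored: "flinear (neg_part_factored p v)"
  by (rule flinearI)
    (auto simp: neg_part_factored_def fscale_def fun_eq_iff cinner_add cinner_scale cinner_add' algebra_simps)

text \<open>
  The factor \<open>I + (z - 1) v v\<^sup>*\<close> undoes \<open>I + (1/z - 1) v v\<^sup>*\<close>; on strictly negative parts,
  indexed by \<open>-1, -2, \<dots>\<close>, it acts as \<^const>\<open>deflate\<close>.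
\<close>

lemma deflate_neg_part_factored:
  assumes "cinner p v v = 1"
  shows "deflate p v (neg_part_factored p v x) = (\<lambda>k. x (- 1 - int k))"
proof -
  have *: "cinner p v (neg_part_factored p v x k) = cinner p v (x (- int k))" for k
    using assms unfolding neg_part_factored_def by (simp add: cinner_add' cinner_diff' cinner_scale2)
  show ?thesis
    unfolding deflate_def * by (auto simp: neg_part_factored_def algebra_simps)
qed

text \<open>
  By \<open>deflate_neg_part_factored\<close>, the map \<^const>\<open>deflate\<close> carries the new reflected range onto the old one.  It
  is injective there unless the constant \<open>v\<close> belongs to the new range, and that would contradict
  the orthogonality of \<open>F u\<close> and \<open>F w\<close>.
\<close>

lemma hankel_rank_reflect_factored_coeffs:
  assumes f: "laurent_coeffs p m N f" "coeffs_orthogonal p N f"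
    and v: "cinner p v v = 1" "const_seq v \<in> hankel_range f"
  shows "hankel_rank (reflect (factored_coeffs p v f)) = hankel_rank (reflect f)"
proof -
  let ?A = "FS.span {laurent_col f (int n) j | n j. True}"
  let ?B = "FS.span {laurent_col f (- 1 - int n) j | n j. True}"
  have W: "neg_part_factored p v ` ?A = hankel_range (reflect (factored_coeffs p v f))"
    by (rule image_hankel_range[OF flinear_neg_part_factored])
      (simp add: neg_part_factored_def laurent_col_def hankel_col_def reflect_def factored_coeffs_def fun_eq_iff algebra_simps minus_diff_commute)
  have "(\<lambda>x k. x (- 1 - int k)) ` ?A = hankel_range (reflect f)"
    by (rule image_hankel_range, rule flinearI)
      (simp_all add: fscale_def laurent_col_def hankel_col_def reflect_def fun_eq_iff algebra_simps)
  then have D: "deflate p v ` hankel_range (reflect (factored_coeffs p v f)) = hankel_range (reflect f)"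
    unfolding W[symmetric] image_image deflate_neg_part_factored[OF v(1)] .
  have Y: "(\<lambda>x k. x (int k)) ` ?B = hankel_range f"
    by (rule image_hankel_range, rule flinearI)
      (simp_all add: fscale_def laurent_col_def hankel_col_def fun_eq_iff algebra_simps)
  have notin: "const_seq v \<notin> hankel_range (reflect (factored_coeffs p v f))"
  proof
    assume "const_seq v \<in> hankel_range (reflect (factored_coeffs p v f))"
    then obtain x where x: "x \<in> ?A" "const_seq v = neg_part_factored p v x" using W by blast
    obtain y where y: "y \<in> ?B" "const_seq v = (\<lambda>k. y (int k))" using v(2) Y by blast
    \<comment> \<open>The strictly negative part of \<open>x\<close> is obtained from \<open>v\<close> by \<open>deflate\<close>, so it vanishes.\<close>
    have xneg: "x k = 0" if "k < 0" for k
    proof -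
      have "(\<lambda>k. x (- 1 - int k)) = 0"
        using deflate_neg_part_factored[OF v(1), of x] x(2) deflate_const_seq[OF v(1)] by simp
      then have "x (- 1 - int (nat (- 1 - k))) = 0" by (metis zero_fun_def)
      then show ?thesis using that by simp
    qed
    have ypos: "y k = 0" if "k > 0" for k
    proof -
      have "y (int (nat k)) = const_seq v (nat k)" using y(2) by metis
      then show ?thesis using that by (simp add: const_seq_def fun_eq_iff)
    qed
    have y0: "y 0 = v"
    proof -
      have "y (int 0) = const_seq v 0" using y(2) by metis
      then show ?thesis by (simp add: const_seq_def fun_eq_iff)
    qed
    obtain M where "(\<Sum>k\<in>{- int M..int M}. cinner p (y k) (x k)) = 0"
      using span_orthogonal[OF f x(1) y(1)] by (auto simp: eventually_sequentially)
    also have "(\<Sum>k\<in>{- int M..int M}. cinner p (y k) (x k)) = (\<Sum>k\<in>{0}. cinner p (y k) (x k))"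
    proof (rule sum.mono_neutral_right)
      show "\<forall>k\<in>{- int M..int M} - {0}. cinner p (y k) (x k) = 0"
      proof
        fix k assume "k \<in> {- int M..int M} - {0}"
        then have "k < 0 \<or> k > 0" by auto
        then show "cinner p (y k) (x k) = 0" using xneg ypos by (auto simp: cinner_def)
      qed
    qed auto
    \<comment> \<open>Only the exponent \<open>0\<close> is common to the supports of \<open>x\<close> and \<open>y\<close>.\<close>
    finally have o: "cinner p v (x 0) = 0" by (simp add: y0)
    have "v i = 0" for i
    proof -
      have "v i = const_seq v 0 i" by (simp add: const_seq_def)
      also have "\<dots> = 0" unfolding x(2) using xneg[of "-1"] by (simp add: neg_part_factored_def o cinner_zero cinner_zero')
      finally show ?thesis .
    qed
    then show False using v(1) by (simp add: cinner_def)
  qed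
  have "FS.dim (deflate p v ` hankel_range (reflect (factored_coeffs p v f))) = FS.dim (hankel_range (reflect (factored_coeffs p v f)))"
  proof (rule dim_image_inj[OF flinear_deflate subspace_hankel_range])
    fix x assume x: "x \<in> hankel_range (reflect (factored_coeffs p v f))" "deflate p v x = 0"
    define c where "c = cinner p v (x 0)"
    have xc: "x = fscale c (const_seq v)" using deflate_eq_0D[OF v(1) x(2)] by (simp add: c_def)
    have "c = 0"
    proof (rule ccontr)
      assume "c \<noteq> 0"
      then have "const_seq v = fscale (1 / c) x" using xc by simp
      then show False using notin x(1) by (metis FS.subspace_scale subspace_hankel_range)
    qed
    then show "x = 0" using xc by simp
  qed
  then show ?thesis by (simp add: hankel_rank_def D)
qed

lemma laurent_coeffs_factored_coeffs:
  assumes f: "laurent_coeffs p m N f" and v: "\<And>i. p \<le> i \<Longrightarrow> v i = 0"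
  shows "laurent_coeffs p m (Suc N) (factored_coeffs p v f)"
  unfolding laurent_coeffs_def
proof (intro allI impI)
  fix k i j assume nz: "factored_coeffs p v f k i j \<noteq> 0"
  have "i < p"
  proof (rule ccontr)
    assume "\<not> i < p"
    then show False using nz v[of i] laurent_coeffsD[OF f, of k i j] by (simp add: factored_coeffs_def)
  qed
  moreover have "j < m"
  proof (rule ccontr)
    assume "\<not> j < m"
    then have "f k l j = 0" for k l using laurent_coeffsD[OF f, of k l j] by simp
    then show False using nz by (simp add: factored_coeffs_def cinner_zero')
  qed
  moreover have "\<bar>k\<bar> \<le> int (Suc N)"
  proof (rule ccontr)
    assume "\<not> \<bar>k\<bar> \<le> int (Suc N)"
    then have "f k l j = 0" "f (k + 1) l j = 0" for l
      by (auto intro!: laurent_coeffsD[OF f])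
    then show False using nz by (simp add: factored_coeffs_def cinner_zero')
  qed
  ultimately show "\<bar>k\<bar> \<le> int (Suc N) \<and> i < p \<and> j < m" by simp
qed

section \<open>The McMillan degree is a Hankel rank\<close>

lemma mat_inv_unique:
  assumes A: "A \<in> carrier_mat n n" and B: "B \<in> carrier_mat n n" and AB: "A * B = 1\<^sub>m n"
  shows "mat_inv A = B"
proof -
  have BA: "B * A = 1\<^sub>m n" by (rule mat_mult_left_right_inverse[OF A B AB])
  have "A \<in> Units (ring_mat TYPE(complex) n ())"
    unfolding Units_def ring_mat_def using A B AB BA by auto
  then obtain C where C: "mat_inverse A = Some C"
    using mat_inverse(1)[OF A, of "()"] by (cases "mat_inverse A") auto
  from mat_inverse(2)[OF A C] have CC: "C * A = 1\<^sub>m n" "C \<in> carrier_mat n n" by auto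
  have "C = C * (A * B)" using CC AB by simp
  also have "\<dots> = (C * A) * B" by (rule assoc_mult_mat[symmetric, OF CC(2) A B])
  also have "\<dots> = B" using CC B by simp
  finally show ?thesis using C by (simp add: mat_inv_def)
qed

lemma mat_inv_det:
  assumes A: "A \<in> carrier_mat n n" and d: "det A \<noteq> 0"
  shows "mat_inv A \<in> carrier_mat n n" "A * mat_inv A = 1\<^sub>m n" "mat_inv A * A = 1\<^sub>m n"
proof -
  from det_non_zero_imp_unit[OF A d, of "()"] obtain C where C: "mat_inverse A = Some C"
    using mat_inverse(1)[OF A, of "()"] by (cases "mat_inverse A") auto
  then show "mat_inv A \<in> carrier_mat n n" "A * mat_inv A = 1\<^sub>m n" "mat_inv A * A = 1\<^sub>m n"
    using mat_inverse(2)[OF A C] by (auto simp: mat_inv_def)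
qed

lemma resolvent_cofinite:
  fixes A :: "complex mat"
  assumes A: "A \<in> carrier_mat n n"
  shows "\<forall>\<^sub>F z in cofinite. det (z \<cdot>\<^sub>m 1\<^sub>m n - A) \<noteq> 0"
proof -
  have "det (z \<cdot>\<^sub>m 1\<^sub>m n - A) = poly (char_poly A) z" for z
  proof -
    have "z \<cdot>\<^sub>m 1\<^sub>m n - A = - (char_matrix A z)"
      using A by (auto simp: char_matrix_def)
    then show ?thesis using char_poly_matrix[OF A] by simp
  qed
  moreover have "char_poly A \<noteq> 0"
    using degree_monic_char_poly[OF A] by auto
  ultimately show ?thesis
    by (simp add: eventually_cofinite poly_roots_finite)
qed

text \<open>
  The value at \<open>z\<close> of the strictly proper function \<open>\<Sum> h\<^sub>k z^(-k-1)\<close>, truncated at \<open>k < N\<close>.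
\<close>

definition eval_neg_powers ::
  "nat \<Rightarrow> complex \<Rightarrow> (nat \<Rightarrow> nat \<Rightarrow> complex) \<Rightarrow> nat \<Rightarrow> complex" where
  "eval_neg_powers N z h i = (\<Sum>k<N. h k i / z ^ Suc k)"

lemma eval_neg_powers_add: "eval_neg_powers N z (g + h) i = eval_neg_powers N z g i + eval_neg_powers N z h i"
  and eval_neg_powers_scale: "eval_neg_powers N z (fscale c h) i = c * eval_neg_powers N z h i"
  and eval_neg_powers_zero: "eval_neg_powers N z 0 i = 0"
  by (simp_all add: eval_neg_powers_def fscale_def add_divide_distrib sum.distrib sum_distrib_left)

lemma eval_neg_powers_sum: "eval_neg_powers N z (sum g S) i = (\<Sum>a\<in>S. eval_neg_powers N z (g a) i)"
proof -
  have "sum g S k i = (\<Sum>a\<in>S. g a k i)" for k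
    by (induction S rule: infinite_finite_induct) simp_all
  then show ?thesis
    unfolding eval_neg_powers_def by (simp add: sum_divide_distrib) (rule sum.swap)
qed

lemma eval_neg_powers_shift:
  assumes "z \<noteq> 0" "h N = 0"
  shows "eval_neg_powers N z (shift h) i = z * eval_neg_powers N z h i - h 0 i"
proof -
  have "eval_neg_powers N z (shift h) i + h 0 i = (\<Sum>k<Suc N. h k i / z ^ k)"
    by (simp only: eval_neg_powers_def shift_def sum.lessThan_Suc_shift) simp
  also have "\<dots> = z * eval_neg_powers N z h i"
    using assms by (simp add: eval_neg_powers_def sum_distrib_left)
  finally show ?thesis by (simp add: algebra_simps)
qed

text \<open>A strictly proper Laurent polynomial that equals a polynomial is zero.\<close>

lemma eval_neg_powers_eq_polyD:
  assumes ev: "\<forall>\<^sub>F z in cofinite. eval_neg_powers N z h i = poly q z" and k: "k < N"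
  shows "h k i = 0"
proof -
  let ?P = "\<Sum>k<N. monom (h k i) (N - 1 - k)"
  let ?Q = "monom 1 N * q"
  have "\<forall>\<^sub>F z in cofinite. z \<noteq> (0::complex)"
    by (simp add: eventually_cofinite)
  with ev have "\<forall>\<^sub>F z in cofinite. poly (?P - ?Q) z = 0"
  proof eventually_elim
    case (elim z)
    have "z ^ N * poly q z = (\<Sum>k<N. z ^ N * (h k i / z ^ Suc k))"
      unfolding elim(1)[symmetric] eval_neg_powers_def sum_distrib_left ..
    also have "\<dots> = (\<Sum>k<N. h k i * z ^ (N - 1 - k))"
    proof (rule sum.cong[OF refl])
      fix k assume "k \<in> {..<N}"
      then have "z ^ N = z ^ Suc k * z ^ (N - 1 - k)"
        using power_add[of z "Suc k" "N - 1 - k"] by simp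
      then show "z ^ N * (h k i / z ^ Suc k) = h k i * z ^ (N - 1 - k)"
        using elim(2) by simp
    qed
    finally show ?case by (simp add: poly_sum poly_monom)
  qed
  then have "finite {z. poly (?P - ?Q) z \<noteq> 0}" by (simp add: eventually_cofinite)
  then have "infinite {z. poly (?P - ?Q) z = 0}"
    using finite_Collect_not[of "\<lambda>z. poly (?P - ?Q) z = 0"] infinite_UNIV_char_0[where 'a=complex] by blast
  then have "?P = ?Q" using poly_roots_finite[of "?P - ?Q"] by auto
  then have "coeff ?P (N - 1 - k) = coeff ?Q (N - 1 - k)" by simp
  moreover have "coeff ?P (N - 1 - k) = (\<Sum>l<N. if l = k then h l i else 0)"
    unfolding coeff_sum by (rule sum.cong[OF refl]) (use k in auto)
  moreover have "coeff ?Q (N - 1 - k) = 0"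
    using k by (simp add: coeff_monom_mult)
  ultimately show ?thesis using k by simp
qed

text \<open>\<open>G(z)\<close> is the sum of \<open>g\<^sub>k z^(-k)\<close> over \<open>k = 1, \<dots>, N\<close>.\<close>

definition neg_power_expansion ::
  "nat \<Rightarrow> nat \<Rightarrow> nat \<Rightarrow> (int \<Rightarrow> nat \<Rightarrow> nat \<Rightarrow> complex) \<Rightarrow> (complex \<Rightarrow> complex mat) \<Rightarrow> bool" where
  "neg_power_expansion p m N g G \<longleftrightarrow> (\<forall>z. z \<noteq> 0 \<longrightarrow> G z = mat p m (\<lambda>(i, j). eval_neg_powers N z (hankel_col g 0 j) i))"

text \<open>
  The shift on the Hankel range, written in a basis, is the state matrix of a realization.  The
  matrix \<open>\<Psi>\<close> of the values at \<open>z\<close> of the basis elements satisfies \<open>\<Psi> (z I - A) = C\<close>.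
\<close>

lemma realization_exists:
  assumes g: "laurent_coeffs p m N g" and G: "neg_power_expansion p m N g G"
  shows "\<exists>A B C D. realization p m (hankel_rank g) G A B C D"
proof -
  let ?H = "hankel_range g"
  obtain Bs where Bs: "Bs \<subseteq> ?H" "FS.independent Bs" "?H \<subseteq> FS.span Bs" "card Bs = FS.dim ?H"
    by (rule FS.basis_exists)
  have fin: "finite Bs"
    using FS.independent_span_bound[OF _ Bs(2), of "(\<lambda>(n, j). hankel_col g n j) ` ({..<N} \<times> {..<m})"]
      hankel_range_finite_span[OF g] Bs(1) by blast
  define \<delta> where "\<delta> = hankel_rank g"
  obtain b where b: "bij_betw b {..<\<delta>} Bs"
    using finite_same_card_bij[OF finite_lessThan fin, of \<delta>] Bs(4) by (auto simp: \<delta>_def hankel_rank_def)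
  have bH: "b j \<in> ?H" if "j < \<delta>" for j
    using b Bs(1) that by (auto simp: bij_betw_def)
  have "\<exists>c. h = (\<Sum>l<\<delta>. fscale (c l) (b l))" if hH: "h \<in> ?H" for h
  proof -
    obtain u where "h = (\<Sum>a\<in>Bs. fscale (u a) a)"
      using hH Bs(3) FS.span_finite[OF fin] by auto
    also have "\<dots> = (\<Sum>l<\<delta>. fscale (u (b l)) (b l))"
      by (rule sum.reindex_bij_betw[OF b, symmetric])
    finally show ?thesis by (rule exI[of _ "\<lambda>l. u (b l)"])
  qed
  then obtain c where c: "\<And>h. h \<in> ?H \<Longrightarrow> h = (\<Sum>l<\<delta>. fscale (c h l) (b l))"
    by metis
  define A where "A = mat \<delta> \<delta> (\<lambda>(l, j). c (shift (b j)) l)"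
  define B where "B = mat \<delta> m (\<lambda>(l, j). c (hankel_col g 0 j) l)"
  define C where "C = mat p \<delta> (\<lambda>(i, j). b j 0 i)"
  have ABC: "A \<in> carrier_mat \<delta> \<delta>" "B \<in> carrier_mat \<delta> m" "C \<in> carrier_mat p \<delta>"
    by (auto simp: A_def B_def C_def)
  have sev: "eval_neg_powers N z h i = (\<Sum>l<\<delta>. eval_neg_powers N z (b l) i * c h l)" if "h \<in> ?H" for z h i
    by (subst c[OF that]) (simp add: eval_neg_powers_sum eval_neg_powers_scale mult.commute)
  have "\<forall>\<^sub>F z in cofinite. z \<noteq> (0::complex)"
    by (simp add: eventually_cofinite)
  then have "\<forall>\<^sub>F z in cofinite. G z = C * mat_inv (z \<cdot>\<^sub>m 1\<^sub>m \<delta> - A) * B + 0\<^sub>m p m"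
    using resolvent_cofinite[OF ABC(1)]
  proof eventually_elim
    case (elim z)
    define R where "R = z \<cdot>\<^sub>m 1\<^sub>m \<delta> - A"
    define \<Psi> where "\<Psi> = mat p \<delta> (\<lambda>(i, l). eval_neg_powers N z (b l) i)"
    have R: "R \<in> carrier_mat \<delta> \<delta>" and P: "\<Psi> \<in> carrier_mat p \<delta>"
      using ABC by (auto simp: R_def \<Psi>_def)
    note X = mat_inv_det[OF R elim(2)[folded R_def]]
    have "\<Psi> * R = C"
    proof (rule eq_matI)
      fix i j assume "i < dim_row C" "j < dim_col C"
      then have ij: "i < p" "j < \<delta>" by (auto simp: C_def)
      have "(\<Psi> * R) $$ (i, j) = (\<Sum>l<\<delta>. eval_neg_powers N z (b l) i * (z * (if l = j then 1 else 0) - c (shift (b j)) l))"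
        using ij by (simp add: R_def \<Psi>_def A_def scalar_prod_def atLeast0LessThan)
      also have "\<dots> = (\<Sum>l<\<delta>. if l = j then z * eval_neg_powers N z (b l) i else 0)
                     - (\<Sum>l<\<delta>. eval_neg_powers N z (b l) i * c (shift (b j)) l)"
        unfolding sum_subtractf[symmetric] by (rule sum.cong) (auto simp: algebra_simps)
      also have "\<dots> = z * eval_neg_powers N z (b j) i - eval_neg_powers N z (shift (b j)) i"
        using ij sev[OF shift_hankel_range[OF bH[OF ij(2)]]] by simp
      also have "\<dots> = b j 0 i"
      proof -
        have "b j N = 0"
          using hankel_range_support[OF g bH[OF ij(2)], of N] by (auto simp: fun_eq_iff)
        then show ?thesis using eval_neg_powers_shift[OF elim(1)] by simp
      qed
      finally show "(\<Psi> * R) $$ (i, j) = C $$ (i, j)" using ij by (simp add: C_def)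
    qed (use ABC in \<open>auto simp: \<Psi>_def R_def C_def\<close>)
    moreover have "\<Psi> * R * mat_inv R = \<Psi>"
      using assoc_mult_mat[OF P R X(1)] X(2) P by simp
    ultimately have "C * mat_inv R = \<Psi>" by simp
    moreover have "\<Psi> * B = G z"
    proof (rule eq_matI)
      fix i j assume "i < dim_row (G z)" "j < dim_col (G z)"
      then have ij: "i < p" "j < m" using G elim(1) by (auto simp: neg_power_expansion_def)
      then show "(\<Psi> * B) $$ (i, j) = G z $$ (i, j)"
        using G elim(1) sev[OF hankel_col_in_range, of z 0 j i]
        by (simp add: neg_power_expansion_def \<Psi>_def B_def scalar_prod_def atLeast0LessThan)
    qed (use G elim(1) in \<open>auto simp: neg_power_expansion_def \<Psi>_def B_def\<close>)
    ultimately show ?case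
      using G elim(1) by (simp add: R_def neg_power_expansion_def)
  qed
  then have "realization p m \<delta> G A B C (0\<^sub>m p m)"
    unfolding realization_def using ABC by simp
  then show ?thesis unfolding \<delta>_def by blast
qed

text \<open>
  Each element \<open>h\<close> of the Hankel range equals \<open>C (z I - A)\<^sup>-\<^sup>1 x\<close> modulo polynomials for some state
  \<open>x\<close>, and \<open>x\<close> determines \<open>h\<close>.  Working modulo polynomials makes any statement on the behaviour
  of the resolvent at infinity superfluous.  More than \<open>\<nu>\<close> independent elements would have
  linearly dependent states.
\<close>

lemma hankel_rank_le_realization:
  assumes g: "laurent_coeffs p m N g" and G: "neg_power_expansion p m N g G" and r: "realization p m \<nu> G A B C D"
  shows "hankel_rank g \<le> \<nu>"
proof -
  let ?H = "hankel_range g"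
  have ABCD: "A \<in> carrier_mat \<nu> \<nu>" "B \<in> carrier_mat \<nu> m" "C \<in> carrier_mat p \<nu>" "D \<in> carrier_mat p m"
    and ev: "\<forall>\<^sub>F z in cofinite. G z = C * mat_inv (z \<cdot>\<^sub>m 1\<^sub>m \<nu> - A) * B + D"
    using r by (auto simp: realization_def)
  define E where "E z = C * mat_inv (z \<cdot>\<^sub>m 1\<^sub>m \<nu> - A)" for z
  \<comment> \<open>The state \<open>x\<close> represents \<open>h\<close> modulo polynomials.\<close>
  define rel :: "(nat \<Rightarrow> complex) \<Rightarrow> (nat \<Rightarrow> nat \<Rightarrow> complex) \<Rightarrow> bool" where
    "rel x h \<longleftrightarrow> (\<exists>q. \<forall>\<^sub>F z in cofinite. \<forall>i<p. eval_neg_powers N z h i = (\<Sum>l<\<nu>. E z $$ (i, l) * x l) + poly (q i) z)" for x h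
  have nz: "\<forall>\<^sub>F z in cofinite. z \<noteq> (0::complex)"
    by (simp add: eventually_cofinite)
  have res: "\<forall>\<^sub>F z in cofinite. E z \<in> carrier_mat p \<nu> \<and>
      (\<forall>i<p. \<forall>l<\<nu>. (\<Sum>k<\<nu>. E z $$ (i, k) * A $$ (k, l)) = z * E z $$ (i, l) - C $$ (i, l))"
    using resolvent_cofinite[OF ABCD(1)]
  proof eventually_elim
    case (elim z)
    have R: "z \<cdot>\<^sub>m 1\<^sub>m \<nu> - A \<in> carrier_mat \<nu> \<nu>" using ABCD by auto
    note X = mat_inv_det[OF R elim]
    have E: "E z \<in> carrier_mat p \<nu>" using ABCD X by (auto simp: E_def)
    have "E z * (z \<cdot>\<^sub>m 1\<^sub>m \<nu> - A) = C"
      unfolding E_def using assoc_mult_mat[OF ABCD(3) X(1) R] X(3) ABCD by simp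
    then have C: "C $$ (i, l) = (E z * (z \<cdot>\<^sub>m 1\<^sub>m \<nu> - A)) $$ (i, l)" for i l by simp
    have "(\<Sum>k<\<nu>. E z $$ (i, k) * A $$ (k, l)) = z * E z $$ (i, l) - C $$ (i, l)" if il: "i < p" "l < \<nu>" for i l
    proof -
      have "C $$ (i, l) = (\<Sum>k<\<nu>. E z $$ (i, k) * (z * (if k = l then 1 else 0) - A $$ (k, l)))"
        unfolding C using il E ABCD by (simp add: scalar_prod_def atLeast0LessThan)
      also have "\<dots> = (\<Sum>k<\<nu>. if k = l then z * E z $$ (i, k) else 0) - (\<Sum>k<\<nu>. E z $$ (i, k) * A $$ (k, l))"
        unfolding sum_subtractf[symmetric] by (rule sum.cong) (auto simp: algebra_simps)
      finally show ?thesis using il by simp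
    qed
    then show ?case using E by blast
  qed
  have rel_zero: "rel (\<lambda>_. 0) 0"
    unfolding rel_def by (rule exI[of _ "\<lambda>_. 0"]) (simp add: eval_neg_powers_zero)
  have rel_lin: "rel (\<lambda>l. c * x l + y l) (fscale c h + k)" if "rel x h" "rel y k" for c x y h k
  proof -
    obtain q where q: "\<forall>\<^sub>F z in cofinite. \<forall>i<p. eval_neg_powers N z h i = (\<Sum>l<\<nu>. E z $$ (i, l) * x l) + poly (q i) z"
      using \<open>rel x h\<close> by (auto simp: rel_def)
    obtain q' where q': "\<forall>\<^sub>F z in cofinite. \<forall>i<p. eval_neg_powers N z k i = (\<Sum>l<\<nu>. E z $$ (i, l) * y l) + poly (q' i) z"
      using \<open>rel y k\<close> by (auto simp: rel_def)
    have "\<forall>\<^sub>F z in cofinite. \<forall>i<p. eval_neg_powers N z (fscale c h + k) i =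
        (\<Sum>l<\<nu>. E z $$ (i, l) * (c * x l + y l)) + poly (smult c (q i) + q' i) z"
      using q q'
    proof eventually_elim
      case (elim z)
      then show ?case
        unfolding eval_neg_powers_add eval_neg_powers_scale
        by (simp add: algebra_simps sum.distrib sum_distrib_left)
    qed
    then show ?thesis unfolding rel_def by (rule exI[of _ "\<lambda>i. smult c (q i) + q' i"])
  qed
  have rel_shift: "\<exists>x'. rel x' (shift h)" if "rel x h" "h N = 0" for x h
  proof -
    obtain q where "\<forall>\<^sub>F z in cofinite. \<forall>i<p. eval_neg_powers N z h i = (\<Sum>l<\<nu>. E z $$ (i, l) * x l) + poly (q i) z"
      using \<open>rel x h\<close> by (auto simp: rel_def)
    with nz res have "\<forall>\<^sub>F z in cofinite. \<forall>i<p. eval_neg_powers N z (shift h) i =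
        (\<Sum>k<\<nu>. E z $$ (i, k) * (\<Sum>l<\<nu>. A $$ (k, l) * x l)) +
        poly (pCons 0 (q i) + [: (\<Sum>l<\<nu>. C $$ (i, l) * x l) - h 0 i :]) z"
    proof eventually_elim
      case (elim z)
      show ?case
      proof (intro allI impI)
        fix i assume i: "i < p"
        have "(\<Sum>k<\<nu>. E z $$ (i, k) * (\<Sum>l<\<nu>. A $$ (k, l) * x l))
            = (\<Sum>l<\<nu>. (\<Sum>k<\<nu>. E z $$ (i, k) * A $$ (k, l)) * x l)"
          unfolding sum_distrib_left sum_distrib_right by (subst sum.swap) (simp add: mult.assoc)
        also have "\<dots> = (\<Sum>l<\<nu>. (z * E z $$ (i, l) - C $$ (i, l)) * x l)"
          using elim(2) i by simp
        also have "\<dots> = z * (\<Sum>l<\<nu>. E z $$ (i, l) * x l) - (\<Sum>l<\<nu>. C $$ (i, l) * x l)"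
          by (simp add: algebra_simps sum_subtractf sum_distrib_left)
        finally have *: "(\<Sum>k<\<nu>. E z $$ (i, k) * (\<Sum>l<\<nu>. A $$ (k, l) * x l)) = \<dots>" .
        show "eval_neg_powers N z (shift h) i = (\<Sum>k<\<nu>. E z $$ (i, k) * (\<Sum>l<\<nu>. A $$ (k, l) * x l)) +
          poly (pCons 0 (q i) + [: (\<Sum>l<\<nu>. C $$ (i, l) * x l) - h 0 i :]) z"
          unfolding * eval_neg_powers_shift[where h = h and N = N, OF elim(1) that(2)] using elim(3) i by (simp add: algebra_simps)
      qed
    qed
    then show ?thesis
      unfolding rel_def
      by (intro exI[of _ "\<lambda>k. \<Sum>l<\<nu>. A $$ (k, l) * x l"]
          exI[of _ "\<lambda>i. pCons 0 (q i) + [: (\<Sum>l<\<nu>. C $$ (i, l) * x l) - h 0 i :]"])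
  qed
  have rel_hankel_col: "\<exists>x. rel x (hankel_col g n j)" for n j
  proof (cases "j < m")
    case True
    show ?thesis
    proof (induction n)
      case 0
      have "\<forall>\<^sub>F z in cofinite. \<forall>i<p. eval_neg_powers N z (hankel_col g 0 j) i = (\<Sum>l<\<nu>. E z $$ (i, l) * B $$ (l, j)) + poly [: D $$ (i, j) :] z"
        using ev nz res
      proof eventually_elim
        case (elim z)
        show ?case
        proof (intro allI impI)
          fix i assume i: "i < p"
          have "eval_neg_powers N z (hankel_col g 0 j) i = G z $$ (i, j)"
            using G elim(2) i True by (simp add: neg_power_expansion_def)
          then show "eval_neg_powers N z (hankel_col g 0 j) i = (\<Sum>l<\<nu>. E z $$ (i, l) * B $$ (l, j)) + poly [: D $$ (i, j) :] z"
            unfolding elim(1)[folded E_def] using i True conjunct1[OF elim(3)] ABCD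
            by (auto simp: scalar_prod_def atLeast0LessThan)
        qed
      qed
      then show ?case
        unfolding rel_def by (intro exI[of _ "\<lambda>l. B $$ (l, j)"] exI[of _ "\<lambda>i. [: D $$ (i, j) :]"])
    next
      case (Suc n)
      then obtain x where "rel x (hankel_col g n j)" by blast
      moreover have "hankel_col g n j N = 0"
        using hankel_range_support[OF g hankel_col_in_range, of N] by (auto simp: fun_eq_iff)
      ultimately show ?case using rel_shift[of x "hankel_col g n j"] by (simp add: shift_hankel_col)
    qed
  next
    case False
    then have "hankel_col g n j = 0"
      unfolding hankel_col_def by (intro ext, subst laurent_coeffsD[OF g]) auto
    then show ?thesis using rel_zero by auto
  qed
  have rel_ex: "\<exists>x. rel x h" if "h \<in> ?H" for h
    using that
  proof (induction (no_simp) rule: hankel_range_induct)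
    case zero
    then show ?case using rel_zero by blast
  next
    case (step c n j h)
    then show ?case using rel_lin rel_hankel_col by blast
  qed
  have uniq: "h = 0" if rh: "rel (\<lambda>_. 0) h" and "h \<in> ?H" for h
  proof -
    obtain q where q: "\<forall>\<^sub>F z in cofinite. \<forall>i<p. eval_neg_powers N z h i = poly (q i) z"
      using rh by (auto simp: rel_def)
    have "h k i = 0" for k i
    proof (cases "k < N \<and> i < p")
      case True
      from q have "\<forall>\<^sub>F z in cofinite. eval_neg_powers N z h i = poly (q i) z"
        by eventually_elim (use True in blast)
      then show ?thesis using eval_neg_powers_eq_polyD True by blast
    next
      case False
      then show ?thesis using hankel_range_support[OF g that(2), of k i] by auto
    qed
    then show ?thesis by (simp add: fun_eq_iff)
  qed
  obtain Bs where Bs: "Bs \<subseteq> ?H" "FS.independent Bs" "?H \<subseteq> FS.span Bs" "card Bs = FS.dim ?H"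
    by (rule FS.basis_exists)
  have fin: "finite Bs"
    using FS.independent_span_bound[OF _ Bs(2), of "(\<lambda>(n, j). hankel_col g n j) ` ({..<N} \<times> {..<m})"]
      hankel_range_finite_span[OF g] Bs(1) by blast
  show ?thesis
  proof (rule ccontr)
    assume "\<not> hankel_rank g \<le> \<nu>"
    then have "Suc \<nu> \<le> card Bs" using Bs(4) by (simp add: hankel_rank_def)
    then obtain S where S: "S \<subseteq> Bs" "card S = Suc \<nu>" "finite S"
      by (meson obtain_subset_with_card_n)
    obtain e where e: "bij_betw e {..<Suc \<nu>} S"
      using finite_same_card_bij[OF finite_lessThan S(3), of "Suc \<nu>"] S(2) by auto
    obtain x where x: "\<And>h. h \<in> ?H \<Longrightarrow> rel (x h) h" using rel_ex by metis
    \<comment> \<open>A zero row makes the matrix of the states square and singular.\<close>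
    define M where "M = mat\<^sub>r (Suc \<nu>) (Suc \<nu>) (\<lambda>i. if i = \<nu> then 0\<^sub>v (Suc \<nu>) else vec (Suc \<nu>) (\<lambda>j. x (e j) i))"
    have Mc: "M \<in> carrier_mat (Suc \<nu>) (Suc \<nu>)" by (simp add: M_def)
    have "det M = 0"
      unfolding M_def by (rule det_row_0) auto
    then obtain w where w: "w \<in> carrier_vec (Suc \<nu>)" "w \<noteq> 0\<^sub>v (Suc \<nu>)" "M *\<^sub>v w = 0\<^sub>v (Suc \<nu>)"
      using det_0_iff_vec_prod_zero_field[OF Mc] by blast
    have eH: "e j \<in> ?H" if "j < Suc \<nu>" for j
      using e S(1) Bs(1) that by (auto simp: bij_betw_def)
    have relsum: "rel (\<lambda>l. \<Sum>j<n. w $ j * x (e j) l) (\<Sum>j<n. fscale (w $ j) (e j))" if "n \<le> Suc \<nu>" for n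
      using that
    proof (induction n)
      case 0
      show ?case unfolding lessThan_0 sum.empty by (rule rel_zero)
    next
      case (Suc n)
      then have "rel (\<lambda>l. \<Sum>j<n. w $ j * x (e j) l) (\<Sum>j<n. fscale (w $ j) (e j))" "n < Suc \<nu>" by auto
      from rel_lin[OF x[OF eH[OF this(2)]] this(1), of "w $ n"] show ?case
        by (simp only: sum.lessThan_Suc add.commute)
    qed
    have zero: "(\<Sum>j<Suc \<nu>. w $ j * x (e j) l) = 0" if "l < \<nu>" for l
    proof -
      have "(M *\<^sub>v w) $ l = row M l \<bullet> w"
        using that Mc by simp
      also have "\<dots> = (\<Sum>j<Suc \<nu>. M $$ (l, j) * w $ j)"
        using that w(1) Mc by (auto simp: scalar_prod_def atLeast0LessThan)
      also have "\<dots> = (\<Sum>j<Suc \<nu>. w $ j * x (e j) l)"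
        by (rule sum.cong[OF refl]) (use that in \<open>simp add: M_def mult.commute\<close>)
      finally show ?thesis using w(3) that by (simp del: sum.lessThan_Suc)
    qed
    have "rel (\<lambda>_. 0) (\<Sum>j<Suc \<nu>. fscale (w $ j) (e j))"
    proof -
      have "(\<Sum>l<\<nu>. E z $$ (i, l) * (\<Sum>j<Suc \<nu>. w $ j * x (e j) l)) = (\<Sum>l<\<nu>. E z $$ (i, l) * 0)" for z i
        by (rule sum.cong[OF refl]) (simp only: zero lessThan_iff)
      then show ?thesis
        using relsum[OF order_refl] unfolding rel_def by (simp only:)
    qed
    moreover have "(\<Sum>j<Suc \<nu>. fscale (w $ j) (e j)) \<in> ?H"
      by (intro FS.subspace_sum FS.subspace_scale subspace_hankel_range eH) simp
    ultimately have "(\<Sum>j<Suc \<nu>. fscale (w $ j) (e j)) = 0" by (rule uniq)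
    moreover have "(\<Sum>j<Suc \<nu>. fscale (w $ j) (e j)) = (\<Sum>h\<in>S. fscale (w $ inv_into {..<Suc \<nu>} e h) h)"
      unfolding sum.reindex_bij_betw[OF e, symmetric]
      by (rule sum.cong[OF refl]) (use e in \<open>auto simp: bij_betw_def inv_into_f_f\<close>)
    ultimately have s0: "(\<Sum>h\<in>S. fscale (w $ inv_into {..<Suc \<nu>} e h) h) = 0" by simp
    have "w $ j = 0" if "j < Suc \<nu>" for j
    proof -
      have "e j \<in> S" using e that by (auto simp: bij_betw_def)
      then have "w $ inv_into {..<Suc \<nu>} e (e j) = 0"
        by (rule FS.independentD[OF Bs(2) S(3,1) s0])
      then show ?thesis using e that by (simp add: bij_betw_def inv_into_f_f)
    qed
    then have "w = 0\<^sub>v (Suc \<nu>)" using w(1) by (intro eq_vecI) auto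
    then show False using w(2) by simp
  qed
qed

theorem proper_mcmillan_degree_eq_hankel_rank:
  assumes "laurent_coeffs p m N g" "neg_power_expansion p m N g G"
  shows "proper_mcmillan_degree p m G = hankel_rank g"
  unfolding proper_mcmillan_degree_def
proof (rule Least_equality)
  show "\<exists>A B C D. realization p m (hankel_rank g) G A B C D"
    by (rule realization_exists[OF assms])
qed (use hankel_rank_le_realization[OF assms] in blast)

section \<open>Laurent polynomials and elementary factors\<close>

text \<open>\<open>F\<close> agrees with the Laurent polynomial with coefficients \<open>f\<close> away from \<open>0\<close>.\<close>

definition laurent_expansion ::
  "nat \<Rightarrow> nat \<Rightarrow> nat \<Rightarrow> (int \<Rightarrow> nat \<Rightarrow> nat \<Rightarrow> complex) \<Rightarrow> (complex \<Rightarrow> complex mat) \<Rightarrow> bool" where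
  "laurent_expansion p m N f F \<longleftrightarrow> laurent_coeffs p m N f \<and>
     (\<forall>z. z \<noteq> 0 \<longrightarrow> F z = mat p m (\<lambda>(i, j). \<Sum>k\<in>{- int N..int N}. f k i j * z powi k))"

lemma laurent_expansion_carrier: "laurent_expansion p m N f F \<Longrightarrow> z \<noteq> 0 \<Longrightarrow> F z \<in> carrier_mat p m"
  by (simp add: laurent_expansion_def)

lemma laurent_expansion_index:
  assumes F: "laurent_expansion p m N f F" and S: "finite S" "{- int N..int N} \<subseteq> S" and z: "z \<noteq> 0" "i < p" "j < m"
  shows "F z $$ (i, j) = (\<Sum>k\<in>S. f k i j * z powi k)"
proof -
  have "F z $$ (i, j) = (\<Sum>k\<in>{- int N..int N}. f k i j * z powi k)"
    using F z by (simp add: laurent_expansion_def)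
  also have "\<dots> = (\<Sum>k\<in>S. f k i j * z powi k)"
  proof (rule sum.mono_neutral_left[OF S])
    show "\<forall>k\<in>S - {- int N..int N}. f k i j * z powi k = 0"
      using F laurent_coeffsD[of p m N f _ i j] by (auto simp: laurent_expansion_def)
  qed
  finally show ?thesis .
qed

lemma laurent_expansionI:
  assumes "laurent_coeffs p m N f" "\<And>z. z \<noteq> 0 \<Longrightarrow> F z \<in> carrier_mat p m"
    "\<And>z i j. z \<noteq> 0 \<Longrightarrow> i < p \<Longrightarrow> j < m \<Longrightarrow> F z $$ (i, j) = (\<Sum>k\<in>{- int N..int N}. f k i j * z powi k)"
  shows "laurent_expansion p m N f F"
  unfolding laurent_expansion_def
proof (intro conjI allI impI)
  fix z :: complex assume z: "z \<noteq> 0"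
  show "F z = mat p m (\<lambda>(i, j). \<Sum>k\<in>{- int N..int N}. f k i j * z powi k)"
    using assms(2)[OF z] by (intro eq_matI) (auto simp: assms(3)[OF z])
qed fact

lemma laurent_expansion_reflect:
  assumes F: "laurent_expansion p m N f F"
  shows "laurent_expansion p m N (reflect f) (\<lambda>z. F (1 / z))"
proof (rule laurent_expansionI)
  show "laurent_coeffs p m N (reflect f)" using F laurent_coeffs_reflect by (auto simp: laurent_expansion_def)
  fix z :: complex and i j assume z: "z \<noteq> 0" "i < p" "j < m"
  have "F (1 / z) $$ (i, j) = (\<Sum>k\<in>{- int N..int N}. f k i j * (1 / z) powi k)"
    by (rule laurent_expansion_index[OF F]) (use z in auto)
  also have "\<dots> = (\<Sum>k\<in>{- int N..int N}. reflect f k i j * z powi k)"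
    by (rule sum.reindex_bij_witness[of _ uminus uminus])
      (auto simp: reflect_def power_int_minus power_int_divide_distrib field_simps)
  finally show "F (1 / z) $$ (i, j) = (\<Sum>k\<in>{- int N..int N}. reflect f k i j * z powi k)" .
qed (use laurent_expansion_carrier[OF F] in auto)

lemma elem_factor_carrier [simp]: "elem_factor n w v \<in> carrier_mat n n"
  by (simp add: elem_factor_def)

lemma dim_elem_factor [simp]: "dim_row (elem_factor n w v) = n" "dim_col (elem_factor n w v) = n"
  by (simp_all add: elem_factor_def)

lemma elem_factor_index:
  "i < n \<Longrightarrow> l < n \<Longrightarrow> elem_factor n w v $$ (i, l) = (if i = l then 1 else 0) + (w - 1) * (v $ i * cnj (v $ l))"
  by (simp add: elem_factor_def)

lemma unit_vec_cinner: "v \<in> carrier_vec n \<Longrightarrow> conjugate v \<bullet> v = cinner n (\<lambda>i. v $ i) (\<lambda>i. v $ i)"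
  by (simp add: scalar_prod_def cinner_def atLeast0LessThan)

lemma elem_factor_mult_index:
  assumes "A \<in> carrier_mat n m" "i < n" "j < m"
  shows "(elem_factor n w v * A) $$ (i, j) = A $$ (i, j) + (w - 1) * v $ i * cinner n (\<lambda>i. v $ i) (\<lambda>l. A $$ (l, j))"
proof -
  have "(elem_factor n w v * A) $$ (i, j) = (\<Sum>l<n. elem_factor n w v $$ (i, l) * A $$ (l, j))"
    using assms elem_factor_carrier[of n w v] by (auto simp: scalar_prod_def atLeast0LessThan)
  also have "\<dots> = (\<Sum>l<n. (if i = l then A $$ (l, j) else 0) + (w - 1) * v $ i * (cnj (v $ l) * A $$ (l, j)))"
    by (rule sum.cong) (use assms in \<open>auto simp: elem_factor_index algebra_simps\<close>)
  also have "\<dots> = A $$ (i, j) + (w - 1) * v $ i * cinner n (\<lambda>i. v $ i) (\<lambda>l. A $$ (l, j))"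
    using assms by (simp add: sum.distrib cinner_def sum_distrib_left)
  finally show ?thesis .
qed

lemma elem_factor_mult:
  assumes v: "v \<in> carrier_vec n" "conjugate v \<bullet> v = 1" and w: "w * w' = 1"
  shows "elem_factor n w v * elem_factor n w' v = 1\<^sub>m n"
proof (rule eq_matI)
  fix i j assume "i < dim_row (1\<^sub>m n :: complex mat)" "j < dim_col (1\<^sub>m n :: complex mat)"
  then have ij: "i < n" "j < n" by auto
  let ?v = "\<lambda>i. v $ i"
  have "cinner n ?v (\<lambda>l. elem_factor n w' v $$ (l, j)) = (\<Sum>l<n. (if l = j then cnj (v $ l) else 0) + (w' - 1) * cnj (v $ j) * (cnj (v $ l) * v $ l))"
    unfolding cinner_def by (rule sum.cong) (use ij in \<open>auto simp: elem_factor_index algebra_simps\<close>)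
  also have "\<dots> = cnj (v $ j) + (w' - 1) * cnj (v $ j) * cinner n ?v ?v"
    using ij by (simp add: sum.distrib cinner_def sum_distrib_left)
  also have "cinner n ?v ?v = 1" using v unit_vec_cinner by metis
  finally have "cinner n ?v (\<lambda>l. elem_factor n w' v $$ (l, j)) = w' * cnj (v $ j)"
    by (simp add: algebra_simps)
  then have "(elem_factor n w v * elem_factor n w' v) $$ (i, j)
      = (if i = j then 1 else 0) + (w' - 1) * (v $ i * cnj (v $ j)) + (w * w' - w') * (v $ i * cnj (v $ j))"
    using ij by (simp add: elem_factor_mult_index[OF elem_factor_carrier ij] elem_factor_index algebra_simps)
  also have "\<dots> = (if i = j then 1 else 0)"
    unfolding w by (simp add: algebra_simps)
  finally show "(elem_factor n w v * elem_factor n w' v) $$ (i, j) = 1\<^sub>m n $$ (i, j)"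
    using ij by simp
qed (auto simp: elem_factor_def)

lemma mat_adjoint_mat: "mat_adjoint A = mat (dim_col A) (dim_row A) (\<lambda>(i, j). cnj (A $$ (j, i)))"
  for A :: "complex mat"
  by (rule eq_matI) (auto simp: mat_adjoint_def mat_of_rows_def)

lemma mat_adjoint_carrier: "A \<in> carrier_mat n m \<Longrightarrow> mat_adjoint A \<in> carrier_mat m n" for A :: "complex mat"
  by (auto simp: mat_adjoint_mat)

lemma mat_adjoint_mult:
  fixes A B :: "complex mat"
  assumes "A \<in> carrier_mat n m" "B \<in> carrier_mat m r"
  shows "mat_adjoint (A * B) = mat_adjoint B * mat_adjoint A"
  using assms by (intro eq_matI) (auto simp: mat_adjoint_mat scalar_prod_def mult.commute)

lemma mat_adjoint_elem_factor: "mat_adjoint (elem_factor n w v) = elem_factor n (cnj w) v"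
  by (rule eq_matI) (auto simp: mat_adjoint_mat elem_factor_def)

text \<open>\<open>F\<close> has \<open>m\<close> orthonormal columns at each point of the unit circle.\<close>

definition isometric_on_circle ::
  "nat \<Rightarrow> (complex \<Rightarrow> complex mat) \<Rightarrow> bool" where
  "isometric_on_circle m F \<longleftrightarrow> (\<forall>z. cmod z = 1 \<longrightarrow> mat_adjoint (F z) * F z = 1\<^sub>m m)"

lemma mat_adjoint_mult_isometric:
  fixes A B :: "complex mat"
  assumes "A \<in> carrier_mat n n" "B \<in> carrier_mat n m" "mat_adjoint A * A = 1\<^sub>m n"
  shows "mat_adjoint (A * B) * (A * B) = mat_adjoint B * B"
proof -
  have c: "mat_adjoint A \<in> carrier_mat n n" "mat_adjoint B \<in> carrier_mat m n"
    using assms mat_adjoint_carrier by auto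
  have "mat_adjoint (A * B) * (A * B) = mat_adjoint B * (mat_adjoint A * (A * B))"
    unfolding mat_adjoint_mult[OF assms(1,2)]
    by (rule assoc_mult_mat[OF c(2) c(1)]) (use assms in auto)
  also have "mat_adjoint A * (A * B) = (mat_adjoint A * A) * B"
    by (rule assoc_mult_mat[symmetric, OF c(1) assms(1,2)])
  finally show ?thesis using assms by simp
qed

lemma circle_mult_cnj:
  assumes "cmod z = 1"
  shows "z * cnj z = 1" "cnj z * z = 1" "cnj z = 1 / z"
proof -
  show *: "z * cnj z = 1" using complex_norm_square[of z] assms by simp
  then show "cnj z * z = 1" by (simp add: mult.commute)
  then show "cnj z = 1 / z" by (metis eq_divide_imp mult_zero_right zero_neq_one)
qed

lemma elem_factor_unitary:
  assumes v: "v \<in> carrier_vec n" "conjugate v \<bullet> v = 1" and w: "cmod w = 1"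
  shows "mat_adjoint (elem_factor n w v) * elem_factor n w v = 1\<^sub>m n"
  unfolding mat_adjoint_elem_factor by (rule elem_factor_mult[OF v]) (rule circle_mult_cnj[OF w])

lemma laurent_expansion_factored_coeffs:
  assumes F: "laurent_expansion p m N f F" and v: "v \<in> carrier_vec p"
    and V: "\<And>i. i < p \<Longrightarrow> V i = v $ i" "\<And>i. p \<le> i \<Longrightarrow> V i = 0"
  shows "laurent_expansion p m (Suc N) (factored_coeffs p V f) (\<lambda>z. elem_factor p (1 / z) v * F z)"
proof (rule laurent_expansionI)
  have f: "laurent_coeffs p m N f" using F by (simp add: laurent_expansion_def)
  show "laurent_coeffs p m (Suc N) (factored_coeffs p V f)" by (rule laurent_coeffs_factored_coeffs[OF f V(2)])
  show "elem_factor p (1 / z) v * F z \<in> carrier_mat p m" if "z \<noteq> 0" for z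
    using laurent_expansion_carrier[OF F that] by (intro mult_carrier_mat[OF elem_factor_carrier])
  fix z :: complex and i j assume z: "z \<noteq> 0" "i < p" "j < m"
  let ?S = "{- int (Suc N)..int (Suc N)}"
  have ipV: "cinner p (\<lambda>i. v $ i) = cinner p V"
    by (simp add: cinner_def V fun_eq_iff)
  have ev: "F z $$ (l, j) = (\<Sum>k\<in>?S. f k l j * z powi k)" if "l < p" for l
    by (rule laurent_expansion_index[OF F]) (use z that in auto)
  have ev': "(1 / z) * F z $$ (l, j) = (\<Sum>k\<in>?S. f (k + 1) l j * z powi k)" if "l < p" for l
  proof -
    have "F z $$ (l, j) = (\<Sum>k\<in>{- int N..int N + 2}. f k l j * z powi k)"
      by (rule laurent_expansion_index[OF F]) (use z that in auto)
    then have "(1 / z) * F z $$ (l, j) = (\<Sum>k\<in>{- int N..int N + 2}. f k l j * z powi (k - 1))"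
      using z by (simp add: sum_distrib_left power_int_diff field_simps)
    also have "\<dots> = (\<Sum>k\<in>?S. f (k + 1) l j * z powi k)"
      by (rule sum.reindex_bij_witness[of _ "\<lambda>k. k + 1" "\<lambda>k. k - 1"]) auto
    finally show ?thesis .
  qed
  have ips: "cinner p V (\<lambda>l. \<Sum>k\<in>?S. h k l * z powi k) = (\<Sum>k\<in>?S. cinner p V (h k) * z powi k)" for h
    unfolding cinner_def sum_distrib_left sum_distrib_right by (subst sum.swap) (simp add: mult.assoc)
  have "(elem_factor p (1 / z) v * F z) $$ (i, j)
      = F z $$ (i, j) - V i * cinner p V (\<lambda>l. F z $$ (l, j)) + V i * cinner p V (\<lambda>l. (1 / z) * F z $$ (l, j))"
    unfolding cinner_scale elem_factor_mult_index[OF laurent_expansion_carrier[OF F z(1)] z(2,3)] ipV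
    using V(1)[OF z(2)] by (simp add: algebra_simps)
  also have "cinner p V (\<lambda>l. F z $$ (l, j)) = (\<Sum>k\<in>?S. cinner p V (\<lambda>l. f k l j) * z powi k)"
    unfolding ips[symmetric] by (simp add: cinner_def ev)
  also have "cinner p V (\<lambda>l. (1 / z) * F z $$ (l, j)) = (\<Sum>k\<in>?S. cinner p V (\<lambda>l. f (k + 1) l j) * z powi k)"
    unfolding ips[symmetric] using ev' by (simp add: cinner_def)
  finally show "(elem_factor p (1 / z) v * F z) $$ (i, j) = (\<Sum>k\<in>?S. factored_coeffs p V f k i j * z powi k)"
    unfolding ev[OF z(2)] by (simp add: factored_coeffs_def algebra_simps sum.distrib sum_subtractf sum_distrib_left)
qed

section \<open>Factorization of isometric Laurent polynomials\<close>

lemma infinite_unit_circle: "infinite {z :: complex. cmod z = 1}"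
proof
  assume fin: "finite {z :: complex. cmod z = 1}"
  define n where "n = Suc (card {z :: complex. cmod z = 1})"
  have "{z :: complex. z ^ n = 1} \<subseteq> {z. cmod z = 1}"
  proof clarify
    fix z :: complex assume "z ^ n = 1"
    then have "cmod z ^ n = 1" by (metis norm_one norm_power)
    then show "cmod z = 1" using power_eq_imp_eq_base[of "cmod z" n 1] by (simp add: n_def)
  qed
  then have "card {z :: complex. z ^ n = 1} \<le> card {z :: complex. cmod z = 1}"
    by (rule card_mono[OF fin])
  then show False using card_roots_unity_eq[of n] by (simp add: n_def)
qed

text \<open>
  For \<open>|z| = 1\<close> the conjugate of \<open>z\<close> is \<open>1/z\<close>, so isometry is a Laurent polynomial identity at
  infinitely many points and can be read off coefficientwise.
\<close>

lemma isometric_coeffs_orthogonal: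
  assumes F: "laurent_expansion p m N f F" and iso: "isometric_on_circle m F"
  shows "coeffs_orthogonal p N f"
  unfolding coeffs_orthogonal_def
proof (intro allI impI)
  fix s j l assume s: "s \<noteq> (0::int)"
  have f: "laurent_coeffs p m N f" using F by (simp add: laurent_expansion_def)
  let ?I = "{- int N..int N}"
  define c where "c k k' = cinner p (\<lambda>i. f k i j) (\<lambda>i. f k' i l)" for k k'
  show "(\<Sum>k\<in>?I. cinner p (\<lambda>i. f k i j) (\<lambda>i. f (k + s) i l)) = 0"
  proof (cases "j < m \<and> l < m \<and> \<bar>s\<bar> \<le> 2 * int N")
    case False
    have "cnj (f k i j) * f (k + s) i l = 0" if "k \<in> ?I" for k i
    proof -
      have "f k i j = 0 \<or> f (k + s) i l = 0"
        using False that laurent_coeffsD[OF f, of k i j] laurent_coeffsD[OF f, of "k + s" i l] by fastforce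
      then show ?thesis by auto
    qed
    then show ?thesis by (simp add: cinner_def)
  next
    case True
    then have jl: "j < m" "l < m" and s2: "\<bar>s\<bar> \<le> 2 * int N" by auto
    \<comment> \<open>The identity \<open>F(z)\<^sup>* F(z) = I\<close>, multiplied by \<open>z^(2N)\<close> to clear negative powers.\<close>
    define P where "P = (\<Sum>k\<in>?I. \<Sum>k'\<in>?I. monom (c k k') (nat (2 * int N + k' - k)))
        - monom (if j = l then 1 else 0) (2 * N)"
    have "poly P z = 0" if z: "cmod z = 1" for z
    proof -
      have z0: "z \<noteq> 0" using z by auto
      have cz: "cnj (z powi k) = z powi (- k)" for k
      proof -
        have "cnj (z powi k) = (1 / z) powi k"
          by (simp add: power_int_def flip: circle_mult_cnj(3)[OF z])
        then show ?thesis by (simp add: power_int_minus divide_inverse power_int_inverse)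
      qed
      have "(if j = l then 1 else 0) = (\<Sum>i<p. cnj (F z $$ (i, j)) * F z $$ (i, l))"
      proof -
        have "(if j = l then 1 else 0) = (mat_adjoint (F z) * F z) $$ (j, l)"
          using iso z jl by (simp add: isometric_on_circle_def)
        also have "\<dots> = (\<Sum>i<p. cnj (F z $$ (i, j)) * F z $$ (i, l))"
          using laurent_expansion_carrier[OF F z0] jl by (auto simp: mat_adjoint_mat scalar_prod_def atLeast0LessThan)
        finally show ?thesis .
      qed
      also have "\<dots> = (\<Sum>i<p. \<Sum>k\<in>?I. \<Sum>k'\<in>?I. cnj (f k i j) * f k' i l * z powi (k' - k))"
      proof (rule sum.cong[OF refl])
        fix i assume "i \<in> {..<p}"
        then have "F z $$ (i, j) = (\<Sum>k\<in>?I. f k i j * z powi k)" "F z $$ (i, l) = (\<Sum>k\<in>?I. f k i l * z powi k)"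
          using jl z0 by (auto intro!: laurent_expansion_index[OF F])
        then have "cnj (F z $$ (i, j)) * F z $$ (i, l) =
          (\<Sum>k\<in>?I. \<Sum>k'\<in>?I. cnj (f k i j * z powi k) * (f k' i l * z powi k'))"
          by (simp only: cnj_sum sum_product)
        also have "\<dots> = (\<Sum>k\<in>?I. \<Sum>k'\<in>?I. cnj (f k i j) * f k' i l * z powi (k' - k))"
        proof (intro sum.cong[OF refl])
          fix k k'
          have "z powi (k' - k) = z powi (- k) * z powi k'"
            using z0 by (simp flip: power_int_add)
          then show "cnj (f k i j * z powi k) * (f k' i l * z powi k') = cnj (f k i j) * f k' i l * z powi (k' - k)"
            by (simp only: complex_cnj_mult cz) (simp only: ac_simps)
        qed
        finally show "cnj (F z $$ (i, j)) * F z $$ (i, l) =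
          (\<Sum>k\<in>?I. \<Sum>k'\<in>?I. cnj (f k i j) * f k' i l * z powi (k' - k))" .
      qed
      also have "\<dots> = (\<Sum>k\<in>?I. \<Sum>i<p. \<Sum>k'\<in>?I. cnj (f k i j) * f k' i l * z powi (k' - k))"
        by (rule sum.swap)
      also have "\<dots> = (\<Sum>k\<in>?I. \<Sum>k'\<in>?I. c k k' * z powi (k' - k))"
        unfolding c_def cinner_def sum_distrib_right by (intro sum.cong[OF refl] sum.swap)
      finally have "z ^ (2 * N) * (if j = l then 1 else 0) = (\<Sum>k\<in>?I. \<Sum>k'\<in>?I. z ^ (2 * N) * (c k k' * z powi (k' - k)))"
        by (simp add: sum_distrib_left)
      also have "\<dots> = (\<Sum>k\<in>?I. \<Sum>k'\<in>?I. c k k' * z ^ nat (2 * int N + k' - k))"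
      proof (intro sum.cong[OF refl])
        fix k k' assume "k \<in> ?I" "k' \<in> ?I"
        then have "z ^ nat (2 * int N + k' - k) = z powi (int (2 * N) + (k' - k))"
          by (auto simp: power_int_def add_diff_eq)
        also have "\<dots> = z ^ (2 * N) * z powi (k' - k)"
          by (subst power_int_add) (simp_all add: z0 power_int_def nat_mult_distrib)
        finally show "z ^ (2 * N) * (c k k' * z powi (k' - k)) = c k k' * z ^ nat (2 * int N + k' - k)"
          by simp
      qed
      finally show ?thesis by (simp add: P_def poly_sum poly_monom split: if_splits)
    qed
    then have "{z. cmod z = 1} \<subseteq> {z. poly P z = 0}" by blast
    then have "infinite {z. poly P z = 0}" using infinite_unit_circle finite_subset by blast
    then have "P = 0" using poly_roots_finite by blast
    then have "0 = coeff P (nat (2 * int N + s))" by simp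
    also have "\<dots> = (\<Sum>k\<in>?I. \<Sum>k'\<in>?I. if k' = k + s then c k k' else 0)"
    proof -
      have "coeff (monom (if j = l then 1 else 0) (2 * N)) (nat (2 * int N + s)) = (0::complex)"
        using s s2 by auto
      moreover have "coeff (monom (c k k') (nat (2 * int N + k' - k))) (nat (2 * int N + s)) = (if k' = k + s then c k k' else 0)"
        if "k \<in> ?I" "k' \<in> ?I" for k k'
        using that s2 by auto
      ultimately show ?thesis by (simp add: P_def coeff_sum del: coeff_monom)
    qed
    also have "\<dots> = (\<Sum>k\<in>?I. c k (k + s))"
    proof (rule sum.cong[OF refl])
      fix k assume "k \<in> ?I"
      show "(\<Sum>k'\<in>?I. if k' = k + s then c k k' else 0) = c k (k + s)"
      proof (cases "k + s \<in> ?I")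
        case True
        then show ?thesis by simp
      next
        case False
        then have "c k (k + s) = 0"
          unfolding c_def cinner_def by (intro sum.neutral) (auto simp: laurent_coeffsD[OF f])
        then show ?thesis using False by (auto intro!: sum.neutral)
      qed
    qed
    finally show ?thesis by (simp add: c_def)
  qed
qed

text \<open>One factor is split off; exactly one of the two Hankel ranks drops, by one.\<close>

lemma factor_step:
  assumes F: "laurent_expansion p m N f F" and iso: "isometric_on_circle m F" and r: "hankel_rank f = Suc r"
  obtains v N' f' F' where "v \<in> carrier_vec p" "conjugate v \<bullet> v = 1"
    "laurent_expansion p m N' f' F'" "isometric_on_circle m F'" "hankel_rank f' = r"
    "hankel_rank (reflect f') = hankel_rank (reflect f)"
    "\<And>z. z \<noteq> 0 \<Longrightarrow> F z = elem_factor p z v * F' z"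
proof -
  have f: "laurent_coeffs p m N f" using F by (simp add: laurent_expansion_def)
  obtain V where V: "const_seq V \<in> hankel_range f" "cinner p V V = 1" "\<And>i. p \<le> i \<Longrightarrow> V i = 0"
    using exists_unit_const_in_hankel_range[OF f] r by auto
  define v where "v = vec p V"
  have v: "v \<in> carrier_vec p" "conjugate v \<bullet> v = 1" "\<And>i. i < p \<Longrightarrow> V i = v $ i"
    using V(2) by (auto simp: v_def unit_vec_cinner cinner_def)
  let ?F = "\<lambda>z. elem_factor p (1 / z) v * F z"
  have "laurent_expansion p m (Suc N) (factored_coeffs p V f) ?F"
    by (rule laurent_expansion_factored_coeffs[OF F v(1,3) V(3)])
  moreover have "isometric_on_circle m ?F"
    unfolding isometric_on_circle_def
  proof (intro allI impI)
    fix z assume z: "cmod z = 1"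
    have "mat_adjoint (?F z) * ?F z = mat_adjoint (F z) * F z"
      by (rule mat_adjoint_mult_isometric[OF elem_factor_carrier laurent_expansion_carrier[OF F] elem_factor_unitary[OF v(1,2)]])
        (use z in \<open>auto simp: norm_divide\<close>)
    then show "mat_adjoint (?F z) * ?F z = 1\<^sub>m m" using iso z by (simp add: isometric_on_circle_def)
  qed
  moreover have "hankel_rank (factored_coeffs p V f) = r"
    using hankel_rank_factored_coeffs[OF f V(2,1)] r by simp
  moreover have "hankel_rank (reflect (factored_coeffs p V f)) = hankel_rank (reflect f)"
    by (rule hankel_rank_reflect_factored_coeffs[OF f isometric_coeffs_orthogonal[OF F iso] V(2,1)])
  moreover have "F z = elem_factor p z v * ?F z" if "z \<noteq> 0" for z
  proof -
    have "elem_factor p z v * ?F z = elem_factor p z v * elem_factor p (1 / z) v * F z"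
      by (rule assoc_mult_mat[symmetric, OF elem_factor_carrier elem_factor_carrier laurent_expansion_carrier[OF F that]])
    also have "\<dots> = F z"
      using elem_factor_mult[OF v(1,2), of z "1 / z"] laurent_expansion_carrier[OF F that] that by simp
    finally show ?thesis by simp
  qed
  ultimately show thesis using that v(1,2) by blast
qed

lemma mat_prod_simps [simp]:
  "mat_prod n M [] = 1\<^sub>m n" "mat_prod n M (j # js) = M j * mat_prod n M js"
  by (simp_all add: mat_prod_def)

lemma mat_prod_carrier:
  "(\<And>j. j \<in> set js \<Longrightarrow> M j \<in> carrier_mat n n) \<Longrightarrow> mat_prod n M js \<in> carrier_mat n n"
  by (induction js) (auto intro!: mult_carrier_mat)

lemma mat_prod_append:
  assumes "\<And>j. j \<in> set (js @ ks) \<Longrightarrow> M j \<in> carrier_mat n n"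
  shows "mat_prod n M (js @ ks) = mat_prod n M js * mat_prod n M ks"
  using assms
proof (induction js)
  case Nil
  have "mat_prod n M ks \<in> carrier_mat n n" by (rule mat_prod_carrier) (use Nil in auto)
  then show ?case by simp
next
  case (Cons j js)
  have "M j \<in> carrier_mat n n" "mat_prod n M js \<in> carrier_mat n n" "mat_prod n M ks \<in> carrier_mat n n"
    by (auto intro!: mat_prod_carrier Cons.prems)
  then show ?case using Cons by (simp add: assoc_mult_mat[of _ n n _ n _ n])
qed

lemma mat_prod_cong:
  "(\<And>j. j \<in> set js \<Longrightarrow> M j = M' j) \<Longrightarrow> mat_prod n M js = mat_prod n M' js"
  by (induction js) auto

lemma mat_prod_map: "mat_prod n M (map g js) = mat_prod n (\<lambda>j. M (g j)) js"
  by (induction js) auto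

lemma hankel_rank_eq_0D:
  assumes f: "laurent_coeffs p m N f" and r: "hankel_rank f = 0" and k: "k > 0"
  shows "f k i j = 0"
proof -
  obtain B where B: "B \<subseteq> hankel_range f" "FS.independent B" "hankel_range f \<subseteq> FS.span B"
    "card B = FS.dim (hankel_range f)"
    by (rule FS.basis_exists)
  have "finite B"
    using FS.independent_span_bound[OF _ B(2), of "(\<lambda>(n, j). hankel_col f n j) ` ({..<N} \<times> {..<m})"]
      hankel_range_finite_span[OF f] B(1) by blast
  then have "B = {}" using B(4) r by (simp add: hankel_rank_def)
  then have "hankel_col f (nat (k - 1)) j = 0" using B(3) hankel_col_in_range by force
  then have "hankel_col f (nat (k - 1)) j 0 i = 0" by simp
  then show ?thesis using k by (simp add: hankel_col_def)
qed

lemma factor_out: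
  assumes F: "laurent_expansion p m N f F" and iso: "isometric_on_circle m F" and t: "t \<le> hankel_rank f"
  shows "\<exists>v N' f' F'. unit_vectors p t v \<and> laurent_expansion p m N' f' F' \<and> isometric_on_circle m F' \<and>
     hankel_rank f' = hankel_rank f - t \<and> hankel_rank (reflect f') = hankel_rank (reflect f) \<and>
     (\<forall>z. z \<noteq> 0 \<longrightarrow> F z = prod_up p (\<lambda>j. elem_factor p z (v j)) 1 t * F' z)"
  using t
proof (induction t)
  case 0
  have "F z = 1\<^sub>m p * F z" if "z \<noteq> 0" for z using laurent_expansion_carrier[OF F that] by simp
  then show ?case using F iso by (auto simp: unit_vectors_def intro!: exI[of _ F] exI[of _ f] exI[of _ N])
next
  case (Suc t)
  then obtain v N' f' F' where *: "unit_vectors p t v" "laurent_expansion p m N' f' F'" "isometric_on_circle m F'"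
    "hankel_rank f' = hankel_rank f - t" "hankel_rank (reflect f') = hankel_rank (reflect f)"
    "\<And>z. z \<noteq> 0 \<Longrightarrow> F z = prod_up p (\<lambda>j. elem_factor p z (v j)) 1 t * F' z"
    by auto
  have "hankel_rank f' = Suc (hankel_rank f - Suc t)" using *(4) Suc.prems by simp
  from factor_step[OF *(2,3) this] obtain w N'' f'' F'' where
    w: "w \<in> carrier_vec p" "conjugate w \<bullet> w = 1" and
    F'': "laurent_expansion p m N'' f'' F''" "isometric_on_circle m F''" "hankel_rank f'' = hankel_rank f - Suc t"
      "hankel_rank (reflect f'') = hankel_rank (reflect f')"
      "\<And>z. z \<noteq> 0 \<Longrightarrow> F' z = elem_factor p z w * F'' z"
    by metis
  define v' where "v' = v(Suc t := w)"
  have "F z = prod_up p (\<lambda>j. elem_factor p z (v' j)) 1 (Suc t) * F'' z" if z: "z \<noteq> 0" for z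
  proof -
    let ?P = "prod_up p (\<lambda>j. elem_factor p z (v j)) 1 t"
    have P: "?P \<in> carrier_mat p p" by (rule mat_prod_carrier) simp
    have "[1..<Suc (Suc t)] = [1..<Suc t] @ [Suc t]" by simp
    then have "prod_up p (\<lambda>j. elem_factor p z (v' j)) 1 (Suc t)
        = prod_up p (\<lambda>j. elem_factor p z (v' j)) 1 t * mat_prod p (\<lambda>j. elem_factor p z (v' j)) [Suc t]"
      by (simp only: mat_prod_append[where M = "\<lambda>j. elem_factor p z (v' j)", OF elem_factor_carrier])
    also have "prod_up p (\<lambda>j. elem_factor p z (v' j)) 1 t = ?P"
      by (rule mat_prod_cong) (auto simp: v'_def)
    also have "mat_prod p (\<lambda>j. elem_factor p z (v' j)) [Suc t] = elem_factor p z w"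
      using right_mult_one_mat[OF elem_factor_carrier] by (simp add: v'_def)
    finally show ?thesis
      unfolding *(6)[OF z] F''(5)[OF z]
      using assoc_mult_mat[OF P elem_factor_carrier laurent_expansion_carrier[OF F''(1) z]] by simp
  qed
  moreover have "unit_vectors p (Suc t) v'"
    using *(1) w by (auto simp: unit_vectors_def v'_def)
  ultimately show ?case using F''(1-4) *(5) by metis
qed

theorem isometric_factorization:
  assumes F: "laurent_expansion p m N f F" and iso: "isometric_on_circle m F"
  shows "\<exists>v U. iso_data p m (hankel_rank (reflect f) + hankel_rank f) (hankel_rank f) v U \<and>
    eq_laurent F (iso_form1 p (hankel_rank (reflect f) + hankel_rank f) (hankel_rank f) v U)"
proof -
  define a b where "a = hankel_rank f" and "b = hankel_rank (reflect f)"
  obtain v N' g G where 1: "unit_vectors p a v" "laurent_expansion p m N' g G" "isometric_on_circle m G"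
    "hankel_rank g = 0" "hankel_rank (reflect g) = b"
    "\<And>z. z \<noteq> 0 \<Longrightarrow> F z = prod_up p (\<lambda>j. elem_factor p z (v j)) 1 a * G z"
    using factor_out[OF F iso order_refl] by (auto simp: a_def b_def)
  have isor: "isometric_on_circle m (\<lambda>z. G (1 / z))"
    using 1(3) by (simp add: isometric_on_circle_def norm_divide)
  obtain w N'' k K where 2: "unit_vectors p b w" "laurent_expansion p m N'' k K" "isometric_on_circle m K"
    "hankel_rank k = 0" "hankel_rank (reflect k) = 0"
    "\<And>z. z \<noteq> 0 \<Longrightarrow> G (1 / z) = prod_up p (\<lambda>j. elem_factor p z (w j)) 1 b * K z"
    using factor_out[OF laurent_expansion_reflect[OF 1(2)] isor order_refl] 1(4,5) by auto
  have kc: "laurent_coeffs p m N'' k" using 2(2) by (simp add: laurent_expansion_def)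
  have k0: "k s i j = 0" if "s \<noteq> 0" for s i j
  proof (cases "s > 0")
    case True
    then show ?thesis by (rule hankel_rank_eq_0D[OF kc 2(4)])
  next
    case False
    then have "reflect k (- s) i j = 0"
      using that by (intro hankel_rank_eq_0D[OF laurent_coeffs_reflect[OF kc] 2(5)]) auto
    then show ?thesis by (simp add: reflect_def)
  qed
  define U where "U = K 1"
  have K: "K z = U" if "z \<noteq> 0" for z
  proof -
    have "K z = mat p m (\<lambda>(i, j). k 0 i j)" if "z \<noteq> 0" for z
    proof (rule eq_matI)
      fix i j assume "i < dim_row (mat p m (\<lambda>(i, j). k 0 i j))" "j < dim_col (mat p m (\<lambda>(i, j). k 0 i j))"
      then have ij: "i < p" "j < m" by auto
      have "K z $$ (i, j) = (\<Sum>s\<in>{- int N''..int N''}. k s i j * z powi s)"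
        by (rule laurent_expansion_index[OF 2(2)]) (use that ij in auto)
      also have "\<dots> = (\<Sum>s\<in>{0}. k s i j * z powi s)"
        by (rule sum.mono_neutral_right) (use k0 in auto)
      finally show "K z $$ (i, j) = mat p m (\<lambda>(i, j). k 0 i j) $$ (i, j)" using ij by simp
    qed (use laurent_expansion_carrier[OF 2(2) that] in auto)
    then show ?thesis using that by (simp add: U_def)
  qed
  have U: "U \<in> carrier_mat p m" "mat_adjoint U * U = 1\<^sub>m m"
    using laurent_expansion_carrier[OF 2(2), of 1] 2(3) by (auto simp: U_def isometric_on_circle_def)
  \<comment> \<open>The vectors of the first factorization come first, those of the reflected one follow.\<close>
  define x where "x j = (if j \<le> a then v j else w (j - a))" for j
  have "unit_vectors p (b + a) x"
    unfolding unit_vectors_def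
  proof
    fix j assume "j \<in> {1..b + a}"
    then have "j \<in> {1..a} \<or> \<not> j \<le> a \<and> j - a \<in> {1..b}" by auto
    then show "x j \<in> carrier_vec p \<and> conjugate (x j) \<bullet> x j = 1"
      using 1(1) 2(1) unfolding unit_vectors_def x_def by (metis atLeastAtMost_iff)
  qed
  then have data: "iso_data p m (b + a) a x U"
    using U by (simp add: iso_data_def)
  have "F z = iso_form1 p (b + a) a x U z" if z: "z \<noteq> 0" for z
  proof -
    let ?P = "prod_up p (\<lambda>j. elem_factor p z (v j)) 1 a"
    let ?Q = "prod_up p (\<lambda>j. elem_factor p (1 / z) (w j)) 1 b"
    have PQ: "?P \<in> carrier_mat p p" "?Q \<in> carrier_mat p p" by (auto intro!: mat_prod_carrier)
    have "G z = ?Q * U"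
      using 2(6)[of "1 / z"] K[of "1 / z"] z by simp
    then have "F z = ?P * ?Q * U"
      unfolding 1(6)[OF z] using assoc_mult_mat[OF PQ U(1)] by simp
    also have "?P = prod_up p (\<lambda>j. elem_factor p z (x j)) 1 a"
      by (rule mat_prod_cong) (auto simp: x_def)
    also have "?Q = prod_up p (\<lambda>j. elem_factor p (1 / z) (x j)) (a + 1) (b + a)"
    proof -
      have "[a + 1..<Suc (b + a)] = map (\<lambda>i. i + a) [1..<Suc b]"
        by (intro nth_equalityI) (auto simp del: upt_Suc)
      then have "prod_up p (\<lambda>j. elem_factor p (1 / z) (x j)) (a + 1) (b + a)
          = mat_prod p (\<lambda>j. elem_factor p (1 / z) (x (j + a))) [1..<Suc b]"
        by (simp only: mat_prod_map)
      also have "\<dots> = ?Q" by (rule mat_prod_cong) (auto simp: x_def)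
      finally show ?thesis by simp
    qed
    finally show ?thesis by (simp add: iso_form1_def)
  qed
  then show ?thesis using data unfolding a_def b_def eq_laurent_def by blast
qed

section \<open>The McMillan degree of a Laurent polynomial\<close>

lemma fir_expansion_laurent_expansion:
  assumes "fir_expansion p m q n B F"
  obtains N f where "laurent_expansion p m N f F" "\<And>k i j. f k i j \<noteq> 0 \<Longrightarrow> q - int n \<le> k \<and> k \<le> q - 1"
proof -
  have F: "F z = mat p m (\<lambda>(i, k). z powi q * (\<Sum>j=1..n. z powi (- int j) * B j $$ (i, k)))" if "z \<noteq> 0" for z
    using assms that by (simp add: fir_expansion_def)
  define f where "f k i j = (if q - int n \<le> k \<and> k \<le> q - 1 \<and> i < p \<and> j < m then B (nat (q - k)) $$ (i, j) else 0)" for k i j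
  define N where "N = nat (\<bar>q\<bar> + int n)"
  have f: "laurent_coeffs p m N f" by (auto simp: laurent_coeffs_def f_def N_def split: if_splits)
  have "laurent_expansion p m N f F"
  proof (rule laurent_expansionI[OF f])
    fix z :: complex and i k assume z: "z \<noteq> 0" "i < p" "k < m"
    have "F z $$ (i, k) = (\<Sum>j=1..n. B j $$ (i, k) * z powi (q - int j))"
      using z by (simp add: F sum_distrib_left power_int_diff power_int_minus field_simps)
    also have "\<dots> = (\<Sum>s\<in>{q - int n..q - 1}. f s i k * z powi s)"
      by (rule sum.reindex_bij_witness[of _ "\<lambda>s. nat (q - s)" "\<lambda>j. q - int j"]) (use z in \<open>auto simp: f_def\<close>)
    also have "\<dots> = (\<Sum>s\<in>{- int N..int N}. f s i k * z powi s)"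
      by (rule sum.mono_neutral_left) (auto simp: N_def f_def)
    finally show "F z $$ (i, k) = (\<Sum>s\<in>{- int N..int N}. f s i k * z powi s)" .
  qed (simp add: F)
  then show thesis by (rule that) (auto simp: f_def split: if_splits)
qed

lemma laurent_expansion_neg_power_expansion:
  assumes F: "laurent_expansion p m N f F" and f0: "\<And>k i j. k \<le> 0 \<Longrightarrow> f k i j = 0"
  shows "neg_power_expansion p m N f (\<lambda>z. F (1 / z))"
  unfolding neg_power_expansion_def
proof (intro allI impI eq_matI)
  fix z :: complex and i j assume z: "z \<noteq> 0"
    and "i < dim_row (mat p m (\<lambda>(i, j). eval_neg_powers N z (hankel_col f 0 j) i))" "j < dim_col (mat p m (\<lambda>(i, j). eval_neg_powers N z (hankel_col f 0 j) i))"
  then have ij: "i < p" "j < m" by auto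
  have pw: "z * z ^ nat (k - 1) = z ^ nat k" if "1 \<le> k" for k
  proof -
    have "nat k = Suc (nat (k - 1))" using that by simp
    then show ?thesis by simp
  qed
  have "F (1 / z) $$ (i, j) = (\<Sum>k\<in>{- int N..int N}. f k i j * (1 / z) powi k)"
    by (rule laurent_expansion_index[OF F]) (use z ij in auto)
  also have "\<dots> = (\<Sum>k\<in>{1..int N}. f k i j * (1 / z) powi k)"
    by (rule sum.mono_neutral_right) (use f0 in auto)
  also have "\<dots> = (\<Sum>k<N. f (1 + int k) i j / z ^ Suc k)"
    by (rule sum.reindex_bij_witness[of _ "\<lambda>k. 1 + int k" "\<lambda>k. nat (k - 1)"])
      (use z pw in \<open>auto simp: power_int_def power_divide\<close>)
  finally show "F (1 / z) $$ (i, j) = mat p m (\<lambda>(i, j). eval_neg_powers N z (hankel_col f 0 j) i) $$ (i, j)"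
    using ij by (simp add: eval_neg_powers_def hankel_col_def)
next
  fix z :: complex assume "z \<noteq> 0"
  then have "F (1 / z) \<in> carrier_mat p m" by (intro laurent_expansion_carrier[OF F]) simp
  then show "dim_row (F (1 / z)) = dim_row (mat p m (\<lambda>(i, j). eval_neg_powers N z (hankel_col f 0 j) i))"
    "dim_col (F (1 / z)) = dim_col (mat p m (\<lambda>(i, j). eval_neg_powers N z (hankel_col f 0 j) i))" by auto
qed

lemma hankel_rank_cong:
  "(\<And>k i j. k > 0 \<Longrightarrow> f k i j = g k i j) \<Longrightarrow> hankel_rank f = hankel_rank g"
  by (simp add: hankel_rank_def hankel_range_def hankel_col_def)

lemma laurent_expansion_mono:
  assumes "laurent_expansion p m N f F" "N \<le> N'"
  shows "laurent_expansion p m N' f F"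
proof (rule laurent_expansionI)
  show "laurent_coeffs p m N' f" using assms by (force simp: laurent_expansion_def laurent_coeffs_def)
qed (use assms in \<open>auto intro!: laurent_expansion_index[OF assms(1)] laurent_expansion_carrier[OF assms(1)]\<close>)

lemma laurent_expansion_add:
  assumes "laurent_expansion p m N f F" "laurent_expansion p m N g G"
  shows "laurent_expansion p m N (\<lambda>k i j. f k i j + g k i j) (\<lambda>z. F z + G z)"
proof (rule laurent_expansionI)
  show "laurent_coeffs p m N (\<lambda>k i j. f k i j + g k i j)"
    using assms unfolding laurent_expansion_def laurent_coeffs_def by (metis add.right_neutral)
  fix z :: complex and i j assume z: "z \<noteq> 0" "i < p" "j < m"
  then show "(F z + G z) $$ (i, j) = (\<Sum>k\<in>{- int N..int N}. (f k i j + g k i j) * z powi k)"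
    using assms by (simp add: laurent_expansion_def sum.distrib distrib_right)
qed (use assms laurent_expansion_carrier in auto)

text \<open>The constant term enters neither of the two Hankel ranks.\<close>

lemma has_mcmillan_degree_laurent_expansion:
  assumes "has_mcmillan_degree p m F d"
  obtains N f where "laurent_expansion p m N f F" "d = hankel_rank (reflect f) + hankel_rank f"
proof -
  from assms obtain Fl D Fr where F: "strictly_anticausal p m Fl" "D \<in> carrier_mat p m" "strictly_causal p m Fr"
    "\<And>z. z \<noteq> 0 \<Longrightarrow> F z = Fl z + D + Fr z"
    "d = proper_mcmillan_degree p m Fr + proper_mcmillan_degree p m (\<lambda>z. Fl (1 / z))"
    by (auto simp: has_mcmillan_degree_def)
  obtain q n B where "fir_expansion p m q n B Fl" "q > int n"
    using F(1) by (auto simp: strictly_anticausal_def)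
  then obtain N1 fl where l: "laurent_expansion p m N1 fl Fl" "\<And>k i j. k \<le> 0 \<Longrightarrow> fl k i j = 0"
    by (elim fir_expansion_laurent_expansion) force
  obtain q' n' B' where "fir_expansion p m q' n' B' Fr" "q' \<le> 0"
    using F(3) by (auto simp: strictly_causal_def)
  then obtain N2 fr where r: "laurent_expansion p m N2 fr Fr" "\<And>k i j. k \<ge> 0 \<Longrightarrow> fr k i j = 0"
    by (elim fir_expansion_laurent_expansion) force
  have dl: "proper_mcmillan_degree p m (\<lambda>z. Fl (1 / z)) = hankel_rank fl"
    by (rule proper_mcmillan_degree_eq_hankel_rank[of _ _ N1])
      (use l laurent_expansion_neg_power_expansion[OF l] in \<open>auto simp: laurent_expansion_def\<close>)
  have dr: "proper_mcmillan_degree p m Fr = hankel_rank (reflect fr)"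
  proof (rule proper_mcmillan_degree_eq_hankel_rank[of _ _ N2])
    show "laurent_coeffs p m N2 (reflect fr)" using r laurent_coeffs_reflect by (auto simp: laurent_expansion_def)
    have "neg_power_expansion p m N2 (reflect fr) (\<lambda>z. Fr (1 / (1 / z)))"
      by (rule laurent_expansion_neg_power_expansion[OF laurent_expansion_reflect[OF r(1)]]) (simp add: reflect_def r(2))
    then show "neg_power_expansion p m N2 (reflect fr) Fr" by simp
  qed
  define fd where "fd = (\<lambda>(k::int) i j. if k = 0 \<and> i < p \<and> j < m then D $$ (i, j) else 0)"
  have dd: "laurent_expansion p m 0 fd (\<lambda>z. D)"
    by (rule laurent_expansionI) (use F(2) in \<open>auto simp: fd_def laurent_coeffs_def split: if_splits\<close>)
  define N where "N = max N1 N2"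
  let ?f = "\<lambda>k i j. fl k i j + fd k i j + fr k i j"
  have "laurent_expansion p m N ?f (\<lambda>z. Fl z + D + Fr z)"
    by (intro laurent_expansion_add laurent_expansion_mono[OF l(1)] laurent_expansion_mono[OF r(1)] laurent_expansion_mono[OF dd]) (auto simp: N_def)
  then have "laurent_expansion p m N ?f F" using F(4) by (simp add: laurent_expansion_def)
  moreover have "hankel_rank ?f = hankel_rank fl"
    by (rule hankel_rank_cong) (simp add: r(2) fd_def)
  moreover have "hankel_rank (reflect ?f) = hankel_rank (reflect fr)"
    by (rule hankel_rank_cong) (simp add: l(2) fd_def reflect_def)
  ultimately show thesis using that[of N ?f] F(5) dl dr by simp
qed

section \<open>The forms with inverses\<close>

lemma mat_prod_mult_rev:
  assumes "\<And>j. j \<in> set js \<Longrightarrow> M j \<in> carrier_mat n n \<and> M' j \<in> carrier_mat n n \<and> M j * M' j = 1\<^sub>m n"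
  shows "mat_prod n M js * mat_prod n M' (rev js) = 1\<^sub>m n"
  using assms
proof (induction js)
  case (Cons j js)
  have c: "M j \<in> carrier_mat n n" "M' j \<in> carrier_mat n n" "mat_prod n M js \<in> carrier_mat n n"
    "mat_prod n M' (rev js) \<in> carrier_mat n n"
    by (auto intro!: mat_prod_carrier Cons.prems simp: Cons.prems)
  have "mat_prod n M' (rev (j # js)) = mat_prod n M' (rev js) * mat_prod n M' [j]"
    unfolding rev.simps by (rule mat_prod_append) (use Cons.prems in auto)
  then have "mat_prod n M' (rev (j # js)) = mat_prod n M' (rev js) * M' j"
    using right_mult_one_mat[OF c(2)] by simp
  then have "mat_prod n M (j # js) * mat_prod n M' (rev (j # js))
      = M j * (mat_prod n M js * mat_prod n M' (rev js)) * M' j"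
    using c by (simp add: assoc_mult_mat[of _ n n _ n _ n])
  also have "\<dots> = 1\<^sub>m n"
    using Cons.IH Cons.prems right_mult_one_mat[OF c(1)] by simp
  finally show ?case .
qed simp

lemma mat_inv_elem_prod:
  assumes v: "\<And>j. j \<in> set js \<Longrightarrow> v j \<in> carrier_vec n \<and> conjugate (v j) \<bullet> v j = 1" and w: "w * w' = 1"
  shows "mat_inv (mat_prod n (\<lambda>j. elem_factor n w (v j)) (rev js)) = mat_prod n (\<lambda>j. elem_factor n w' (v j)) js"
proof (rule mat_inv_unique)
  have "mat_prod n (\<lambda>j. elem_factor n w (v j)) (rev js) * mat_prod n (\<lambda>j. elem_factor n w' (v j)) (rev (rev js)) = 1\<^sub>m n"
    by (rule mat_prod_mult_rev) (use v in \<open>auto intro: elem_factor_mult w\<close>)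
  then show "mat_prod n (\<lambda>j. elem_factor n w (v j)) (rev js) * mat_prod n (\<lambda>j. elem_factor n w' (v j)) js = 1\<^sub>m n"
    by simp
qed (auto intro!: mat_prod_carrier)

lemma mat_inv_prod_down:
  assumes v: "unit_vectors n d v" and ab: "1 \<le> a" "b \<le> d" and w: "w * w' = 1"
  shows "mat_inv (prod_down n (\<lambda>j. elem_factor n w (v j)) b a) = prod_up n (\<lambda>j. elem_factor n w' (v j)) a b"
  by (rule mat_inv_elem_prod[OF _ w]) (use v ab in \<open>auto simp: unit_vectors_def\<close>)

lemma iso_forms_eq:
  assumes "iso_data p m d \<gamma> v U" "z \<noteq> 0"
  shows "iso_form2 p d \<gamma> v U z = iso_form1 p d \<gamma> v U z" "iso_form3 p d \<gamma> v U z = iso_form1 p d \<gamma> v U z"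
proof -
  have v: "unit_vectors p d v" "\<gamma> \<le> d" using assms(1) by (auto simp: iso_data_def)
  show "iso_form2 p d \<gamma> v U z = iso_form1 p d \<gamma> v U z"
    unfolding iso_form1_def iso_form2_def
    by (subst mat_inv_prod_down[OF v(1), where w' = "1 / z"]) (use assms(2) in auto)
  show "iso_form3 p d \<gamma> v U z = iso_form1 p d \<gamma> v U z"
    unfolding iso_form1_def iso_form3_def
    by (subst mat_inv_prod_down[OF v(1), where w' = z]) (use assms(2) v(2) in auto)
qed

lemma coiso_forms_eq:
  assumes "coiso_data p m d \<gamma> v U" "z \<noteq> 0"
  shows "coiso_form2 m d \<gamma> v U z = coiso_form1 m d \<gamma> v U z" "coiso_form3 m d \<gamma> v U z = coiso_form1 m d \<gamma> v U z"
proof -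
  have v: "unit_vectors m d v" "\<gamma> \<le> d" using assms(1) by (auto simp: coiso_data_def)
  show "coiso_form2 m d \<gamma> v U z = coiso_form1 m d \<gamma> v U z"
    unfolding coiso_form1_def coiso_form2_def
    by (subst mat_inv_prod_down[OF v(1), where w' = "1 / z"]) (use assms(2) in auto)
  show "coiso_form3 m d \<gamma> v U z = coiso_form1 m d \<gamma> v U z"
    unfolding coiso_form1_def coiso_form3_def
    by (subst mat_inv_prod_down[OF v(1), where w' = z]) (use assms(2) v(2) in auto)
qed

section \<open>Causal and anticausal functions\<close>

text \<open>
  The entries of \<open>F\<close> are polynomials in \<open>w z\<close>.  For \<open>w z = 1 / z\<close> such a function is causal, and
  for \<open>w z = z\<close> it is anticausal.
\<close>

definition poly_in ::
  "(complex \<Rightarrow> complex) \<Rightarrow> nat \<Rightarrow> nat \<Rightarrow> (complex \<Rightarrow> complex mat) \<Rightarrow> bool" where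
  "poly_in w p m F \<longleftrightarrow> (\<exists>P. \<forall>z. z \<noteq> 0 \<longrightarrow> F z = mat p m (\<lambda>(i, j). poly (P i j) (w z)))"

lemma poly_in_const: "U \<in> carrier_mat p m \<Longrightarrow> poly_in w p m (\<lambda>z. U)"
  unfolding poly_in_def by (intro exI[of _ "\<lambda>i j. [: U $$ (i, j) :]"]) auto

lemma poly_in_mult:
  assumes "poly_in w p n F" "poly_in w n m G"
  shows "poly_in w p m (\<lambda>z. F z * G z)"
proof -
  obtain P Q where P: "\<And>z. z \<noteq> 0 \<Longrightarrow> F z = mat p n (\<lambda>(i, j). poly (P i j) (w z))"
    and Q: "\<And>z. z \<noteq> 0 \<Longrightarrow> G z = mat n m (\<lambda>(i, j). poly (Q i j) (w z))"
    using assms by (auto simp: poly_in_def)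
  have "F z * G z = mat p m (\<lambda>(i, j). poly (\<Sum>l<n. P i l * Q l j) (w z))" if "z \<noteq> 0" for z
    unfolding P[OF that] Q[OF that] by (rule eq_matI) (auto simp: scalar_prod_def atLeast0LessThan poly_sum)
  then show ?thesis unfolding poly_in_def by (intro exI[of _ "\<lambda>i j. \<Sum>l<n. P i l * Q l j"]) auto
qed

lemma poly_in_elem_prod: "poly_in w n n (\<lambda>z. mat_prod n (\<lambda>j. elem_factor n (w z) (v j)) js)"
proof (induction js)
  case Nil
  show ?case using poly_in_const[of "1\<^sub>m n"] by simp
next
  case (Cons j js)
  have "poly_in w n n (\<lambda>z. elem_factor n (w z) (v j))"
    unfolding poly_in_def
    by (rule exI[of _ "\<lambda>i k. [: if i = k then 1 else 0 :] + [:-1, 1:] * [: v j $ i * cnj (v j $ k) :]"])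
      (auto simp: elem_factor_def algebra_simps intro!: eq_matI)
  from poly_in_mult[OF this Cons] show ?case by simp
qed

lemma poly_in_bounded:
  assumes "poly_in w p m F"
  obtains K c where "\<And>z. z \<noteq> 0 \<Longrightarrow> F z = mat p m (\<lambda>(i, j). \<Sum>k\<le>K. c k i j * w z ^ k)"
proof -
  obtain P where P: "\<And>z. z \<noteq> 0 \<Longrightarrow> F z = mat p m (\<lambda>(i, j). poly (P i j) (w z))"
    using assms by (auto simp: poly_in_def)
  define K where "K = (\<Sum>(i, j)\<in>{..<p} \<times> {..<m}. degree (P i j))"
  have K: "degree (P i j) \<le> K" if "i < p" "j < m" for i j
    unfolding K_def using member_le_sum[of "(i, j)" "{..<p} \<times> {..<m}" "\<lambda>(i, j). degree (P i j)"] that by auto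
  have "poly (P i j) x = (\<Sum>k\<le>K. coeff (P i j) k * x ^ k)" if "i < p" "j < m" for i j x
    unfolding poly_altdef
    by (rule sum.mono_neutral_left) (use K[OF that] in \<open>auto simp: coeff_eq_0\<close>)
  then have "F z = mat p m (\<lambda>(i, j). \<Sum>k\<le>K. coeff (P i j) k * w z ^ k)" if "z \<noteq> 0" for z
    unfolding P[OF that] by (intro eq_matI) auto
  then show thesis by (rule that)
qed

lemma poly_in_causal:
  assumes "poly_in (\<lambda>z. 1 / z) p m F"
  shows "causal p m F"
proof -
  obtain K c where F: "\<And>z. z \<noteq> 0 \<Longrightarrow> F z = mat p m (\<lambda>(i, j). \<Sum>k\<le>K. c k i j * (1 / z) ^ k)"
    using poly_in_bounded[OF assms] by blast
  have "fir_expansion p m 1 (Suc K) (\<lambda>k. mat p m (\<lambda>(i, j). c (k - 1) i j)) F"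
    unfolding fir_expansion_def
  proof (intro conjI ballI allI impI)
    fix z :: complex assume z: "z \<noteq> 0"
    have "(\<Sum>k\<le>K. c k i j * (1 / z) ^ k) = z powi 1 * (\<Sum>k=1..Suc K. z powi - int k * c (k - 1) i j)" for i j
    proof -
      have "z powi 1 * (\<Sum>k=1..Suc K. z powi - int k * c (k - 1) i j) = (\<Sum>k=1..Suc K. z * (z powi - int k * c (k - 1) i j))"
        by (simp only: sum_distrib_left power_int_1_right)
      also have "\<dots> = (\<Sum>k\<le>K. c k i j * (1 / z) ^ k)"
        by (rule sum.reindex_bij_witness[of _ Suc "\<lambda>k. k - 1"])
          (use z in \<open>auto simp: power_int_minus power_divide field_simps simp flip: power_Suc\<close>)
      finally show ?thesis by simp
    qed
    then show "F z = mat p m (\<lambda>(i, j). z powi 1 * (\<Sum>k=1..Suc K. z powi - int k * mat p m (\<lambda>(i, j). c (k - 1) i j) $$ (i, j)))"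
      unfolding F[OF z] by (intro eq_matI) auto
  qed simp
  then show ?thesis unfolding causal_def by fastforce
qed

lemma poly_in_anticausal:
  assumes "poly_in (\<lambda>z. z) p m F"
  shows "anticausal p m F"
proof -
  obtain K c where F: "\<And>z. z \<noteq> 0 \<Longrightarrow> F z = mat p m (\<lambda>(i, j). \<Sum>k\<le>K. c k i j * z ^ k)"
    using poly_in_bounded[OF assms] by blast
  have "fir_expansion p m (int (Suc K)) (Suc K) (\<lambda>k. mat p m (\<lambda>(i, j). c (Suc K - k) i j)) F"
    unfolding fir_expansion_def
  proof (intro conjI ballI allI impI)
    fix z :: complex assume z: "z \<noteq> 0"
    have "(\<Sum>k\<le>K. c k i j * z ^ k) = z powi int (Suc K) * (\<Sum>k=1..Suc K. z powi - int k * c (Suc K - k) i j)" for i j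
    proof -
      have "z powi int (Suc K) * (\<Sum>k=1..Suc K. z powi - int k * c (Suc K - k) i j)
          = (\<Sum>k=1..Suc K. c (Suc K - k) i j * z ^ (Suc K - k))"
        unfolding sum_distrib_left
      proof (rule sum.cong[OF refl])
        fix k assume "k \<in> {1..Suc K}"
        then have "int (Suc K - k) = int (Suc K) + - int k" by auto
        then have "z ^ (Suc K - k) = z powi int (Suc K) * z powi - int k"
          using z by (metis power_int_add power_int_of_nat)
        then show "z powi int (Suc K) * (z powi - int k * c (Suc K - k) i j) = c (Suc K - k) i j * z ^ (Suc K - k)"
          by simp
      qed
      also have "\<dots> = (\<Sum>k\<le>K. c k i j * z ^ k)"
        by (rule sum.reindex_bij_witness[of _ "\<lambda>k. Suc K - k" "\<lambda>k. Suc K - k"]) auto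
      finally show ?thesis by simp
    qed
    then show "F z = mat p m (\<lambda>(i, j). z powi int (Suc K) * (\<Sum>k=1..Suc K. z powi - int k * mat p m (\<lambda>(i, j). c (Suc K - k) i j) $$ (i, j)))"
      unfolding F[OF z] by (intro eq_matI) auto
  qed simp
  then show ?thesis unfolding anticausal_def by fastforce
qed

lemma eq_laurent_poly_in: "eq_laurent F G \<Longrightarrow> poly_in w p m G \<Longrightarrow> poly_in w p m F"
  by (simp add: eq_laurent_def poly_in_def)

lemma iso_form1_causal:
  assumes d: "iso_data p m d \<gamma> v U" and F: "eq_laurent F (iso_form1 p d \<gamma> v U)"
  shows "\<gamma> = 0 \<Longrightarrow> causal p m F" "\<gamma> = d \<Longrightarrow> anticausal p m F"
proof -
  have U: "U \<in> carrier_mat p m" using d by (simp add: iso_data_def)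
  assume "\<gamma> = 0"
  then have e: "[1..<Suc \<gamma>] = []" by simp
  have "poly_in (\<lambda>z. 1 / z) p m (iso_form1 p d \<gamma> v U)"
    unfolding iso_form1_def e mat_prod_simps(1)
    by (intro poly_in_mult[where n = p] poly_in_const poly_in_elem_prod U one_carrier_mat)
  then show "causal p m F" by (rule poly_in_causal[OF eq_laurent_poly_in[OF F]])
next
  have U: "U \<in> carrier_mat p m" using d by (simp add: iso_data_def)
  assume "\<gamma> = d"
  then have e: "[\<gamma> + 1..<Suc d] = []" by simp
  have "poly_in (\<lambda>z. z) p m (iso_form1 p d \<gamma> v U)"
    unfolding iso_form1_def e mat_prod_simps(1)
    by (intro poly_in_mult[where n = p] poly_in_const poly_in_elem_prod U one_carrier_mat)
  then show "anticausal p m F" by (rule poly_in_anticausal[OF eq_laurent_poly_in[OF F]])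
qed

lemma coiso_form1_causal:
  assumes d: "coiso_data p m d \<gamma> v U" and F: "eq_laurent F (coiso_form1 m d \<gamma> v U)"
  shows "\<gamma> = 0 \<Longrightarrow> causal p m F" "\<gamma> = d \<Longrightarrow> anticausal p m F"
proof -
  have U: "U \<in> carrier_mat p m" using d by (simp add: coiso_data_def)
  assume "\<gamma> = 0"
  then have e: "[1..<Suc \<gamma>] = []" by simp
  have "poly_in (\<lambda>z. 1 / z) p m (coiso_form1 m d \<gamma> v U)"
    unfolding coiso_form1_def e mat_prod_simps(1)
    by (intro poly_in_mult[where n = m] poly_in_const poly_in_elem_prod U one_carrier_mat)
  then show "causal p m F" by (rule poly_in_causal[OF eq_laurent_poly_in[OF F]])
next
  have U: "U \<in> carrier_mat p m" using d by (simp add: coiso_data_def)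
  assume "\<gamma> = d"
  then have e: "[\<gamma> + 1..<Suc d] = []" by simp
  have "poly_in (\<lambda>z. z) p m (coiso_form1 m d \<gamma> v U)"
    unfolding coiso_form1_def e mat_prod_simps(1)
    by (intro poly_in_mult[where n = m] poly_in_const poly_in_elem_prod U one_carrier_mat)
  then show "anticausal p m F" by (rule poly_in_anticausal[OF eq_laurent_poly_in[OF F]])
qed

section \<open>Isometric functions\<close>

lemma laurent_expansion_rational_on_circle:
  assumes F: "laurent_expansion p m N f F"
  shows "rational_on_circle p m F"
  unfolding rational_on_circle_def
proof (intro exI conjI allI impI)
  \<comment> \<open>The exponent \<open>N + 1\<close> makes \<open>Q\<close> vanish at \<open>0\<close>, where the value of \<open>F\<close> is arbitrary.\<close>
  let ?Q = "monom 1 (Suc N) :: complex poly"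
  let ?P = "\<lambda>i j. \<Sum>k\<in>{- int N..int N}. monom (f k i j) (nat (k + int (Suc N)))"
  show "poly ?Q z \<noteq> 0" if "cmod z = 1" for z using that by (auto simp: poly_monom)
  fix z assume "poly ?Q z \<noteq> 0"
  then have z: "z \<noteq> 0" by (auto simp: poly_monom)
  have "(\<Sum>k\<in>{- int N..int N}. f k i j * z powi k) = poly (?P i j) z / poly ?Q z" for i j
    unfolding poly_sum poly_monom sum_divide_distrib
  proof (rule sum.cong[OF refl])
    fix k assume "k \<in> {- int N..int N}"
    then have "z ^ nat (k + int (Suc N)) = z powi (k + int (Suc N))" by (simp add: power_int_def)
    also have "\<dots> = z powi k * z powi int (Suc N)" using z by (subst power_int_add) simp_all
    also have "\<dots> = z powi k * z ^ Suc N" by (simp only: power_int_of_nat)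
    finally show "f k i j * z powi k = f k i j * z ^ nat (k + int (Suc N)) / (1 * z ^ Suc N)"
      using z by simp
  qed
  then show "F z = mat p m (\<lambda>(i, j). poly (?P i j) z / poly ?Q z)"
    using F z by (simp add: laurent_expansion_def)
qed

lemma elem_prod_isometric:
  assumes "\<And>j. j \<in> set js \<Longrightarrow> v j \<in> carrier_vec n \<and> conjugate (v j) \<bullet> v j = 1"
    and "cmod w = 1" "B \<in> carrier_mat n m"
  shows "mat_adjoint (mat_prod n (\<lambda>j. elem_factor n w (v j)) js * B) * (mat_prod n (\<lambda>j. elem_factor n w (v j)) js * B)
    = mat_adjoint B * B"
  using assms
proof (induction js)
  case (Cons j js)
  let ?P = "mat_prod n (\<lambda>j. elem_factor n w (v j)) js"
  have P: "?P \<in> carrier_mat n n" by (rule mat_prod_carrier) simp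
  have PB: "?P * B \<in> carrier_mat n m" using P Cons.prems(3) by simp
  have "mat_prod n (\<lambda>j. elem_factor n w (v j)) (j # js) * B = elem_factor n w (v j) * (?P * B)"
    using assoc_mult_mat[OF elem_factor_carrier P Cons.prems(3)] by simp
  then show ?case
    using mat_adjoint_mult_isometric[OF elem_factor_carrier PB elem_factor_unitary[of "v j"]] Cons by auto
qed simp

lemma iso_form1_isometric:
  assumes d: "iso_data p m d \<gamma> v U" and F: "eq_laurent F (iso_form1 p d \<gamma> v U)"
  shows "isometric_on_circle m F"
  unfolding isometric_on_circle_def
proof (intro allI impI)
  fix z assume z: "cmod z = 1"
  have U: "U \<in> carrier_mat p m" "mat_adjoint U * U = 1\<^sub>m m" and g: "\<gamma> \<le> d"
    and v: "\<And>j. j \<in> {1..d} \<Longrightarrow> v j \<in> carrier_vec p \<and> conjugate (v j) \<bullet> v j = 1"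
    using d by (auto simp: iso_data_def unit_vectors_def)
  let ?P = "prod_up p (\<lambda>j. elem_factor p z (v j)) 1 \<gamma>"
  let ?Q = "prod_up p (\<lambda>j. elem_factor p (1 / z) (v j)) (\<gamma> + 1) d"
  have PQ: "?P \<in> carrier_mat p p" "?Q \<in> carrier_mat p p" by (auto intro!: mat_prod_carrier)
  have "z \<noteq> 0" using z by auto
  then have Fz: "F z = ?P * (?Q * U)"
    using F assoc_mult_mat[OF PQ U(1)] by (simp add: eq_laurent_def iso_form1_def)
  have "mat_adjoint (F z) * F z = mat_adjoint (?Q * U) * (?Q * U)"
    unfolding Fz by (rule elem_prod_isometric) (use v g z PQ U in auto)
  also have "\<dots> = mat_adjoint U * U"
    by (rule elem_prod_isometric) (use v g z U in \<open>auto simp: norm_divide\<close>)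
  finally show "mat_adjoint (F z) * F z = 1\<^sub>m m" using U by simp
qed

lemma isometric_iff_iso_form1:
  assumes "has_mcmillan_degree p m F d"
  shows "isometric_on_circle m F \<longleftrightarrow> (\<exists>\<gamma> v U. iso_data p m d \<gamma> v U \<and> eq_laurent F (iso_form1 p d \<gamma> v U))"
proof
  obtain N f where f: "laurent_expansion p m N f F" "d = hankel_rank (reflect f) + hankel_rank f"
    by (rule has_mcmillan_degree_laurent_expansion[OF assms])
  assume "isometric_on_circle m F"
  from isometric_factorization[OF f(1) this]
  show "\<exists>\<gamma> v U. iso_data p m d \<gamma> v U \<and> eq_laurent F (iso_form1 p d \<gamma> v U)"
    unfolding f(2) by blast
qed (use iso_form1_isometric in blast)

section \<open>Transposition\<close>

text \<open>
  Transposing a product of elementary factors conjugates the vectors and reverses the order.  This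
  is the resulting family of vectors, with each of the blocks \<open>1, \<dots>, \<gamma>\<close> and \<open>\<gamma> + 1, \<dots>, d\<close>
  reversed in itself.
\<close>

definition dual_vecs ::
  "nat \<Rightarrow> nat \<Rightarrow> (nat \<Rightarrow> complex vec) \<Rightarrow> nat \<Rightarrow> complex vec" where
  "dual_vecs d \<gamma> v j = conjugate (v (if j \<le> \<gamma> then 1 + \<gamma> - j else \<gamma> + 1 + d - j))"

lemma unit_vectors_dual_vecs:
  assumes "unit_vectors n d v" "\<gamma> \<le> d"
  shows "unit_vectors n d (dual_vecs d \<gamma> v)"
  unfolding unit_vectors_def
proof
  fix j assume "j \<in> {1..d}"
  then have "(if j \<le> \<gamma> then 1 + \<gamma> - j else \<gamma> + 1 + d - j) \<in> {1..d}" (is "?i \<in> _")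
    using assms(2) by auto
  then have v: "v ?i \<in> carrier_vec n" "conjugate (v ?i) \<bullet> v ?i = 1"
    using assms(1) unfolding unit_vectors_def by blast+
  then have "conjugate (conjugate (v ?i)) \<bullet> conjugate (v ?i) = 1"
    by (simp add: scalar_prod_def mult.commute)
  then show "dual_vecs d \<gamma> v j \<in> carrier_vec n \<and> conjugate (dual_vecs d \<gamma> v j) \<bullet> dual_vecs d \<gamma> v j = 1"
    using v unfolding dual_vecs_def by (simp only: carrier_vec_conjugate simp_thms)
qed

lemma transpose_elem_factor:
  "v \<in> carrier_vec n \<Longrightarrow> transpose_mat (elem_factor n w v) = elem_factor n w (conjugate v)"
  by (rule eq_matI) (auto simp: elem_factor_def)

lemma transpose_elem_prod:
  assumes "\<And>j. j \<in> set js \<Longrightarrow> v j \<in> carrier_vec n"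
  shows "transpose_mat (mat_prod n (\<lambda>j. elem_factor n w (v j)) js) =
    mat_prod n (\<lambda>j. elem_factor n w (conjugate (v j))) (rev js)"
  using assms
proof (induction js)
  case (Cons j js)
  let ?E = "\<lambda>j. elem_factor n w (v j)" and ?C = "\<lambda>j. elem_factor n w (conjugate (v j))"
  have P: "mat_prod n ?E js \<in> carrier_mat n n" by (rule mat_prod_carrier) simp
  have "transpose_mat (mat_prod n ?E (j # js)) = transpose_mat (mat_prod n ?E js) * transpose_mat (?E j)"
    using transpose_mult[OF elem_factor_carrier P] by simp
  also have "\<dots> = mat_prod n ?C (rev js) * mat_prod n ?C [j]"
    using Cons transpose_elem_factor[of "v j"] right_mult_one_mat[OF elem_factor_carrier] by simp
  also have "\<dots> = mat_prod n ?C (rev (j # js))"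
    unfolding rev.simps by (rule mat_prod_append[symmetric]) simp
  finally show ?case .
qed simp

lemma transpose_prod_up:
  assumes "unit_vectors n d v" "1 \<le> a" "b \<le> d"
    and u: "\<And>j. a \<le> j \<Longrightarrow> j \<le> b \<Longrightarrow> u j = conjugate (v (a + b - j))"
  shows "transpose_mat (prod_up n (\<lambda>j. elem_factor n w (v j)) a b) = prod_up n (\<lambda>j. elem_factor n w (u j)) a b"
proof -
  have "rev [a..<Suc b] = map (\<lambda>j. a + b - j) [a..<Suc b]"
    by (rule nth_equalityI) (auto simp: rev_nth simp del: upt_Suc)
  then have "transpose_mat (prod_up n (\<lambda>j. elem_factor n w (v j)) a b)
      = mat_prod n (\<lambda>j. elem_factor n w (conjugate (v (a + b - j)))) [a..<Suc b]"
    using transpose_elem_prod[of "[a..<Suc b]" v n w] assms(1-3)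
    by (auto simp: unit_vectors_def mat_prod_map simp del: upt_Suc)
  also have "\<dots> = prod_up n (\<lambda>j. elem_factor n w (u j)) a b"
    by (rule mat_prod_cong) (auto simp: u simp del: upt_Suc)
  finally show ?thesis .
qed

lemma transpose_prod_up_dual:
  assumes "unit_vectors n d v" "\<gamma> \<le> d"
  shows "transpose_mat (prod_up n (\<lambda>j. elem_factor n w (v j)) 1 \<gamma>) =
      prod_up n (\<lambda>j. elem_factor n w (dual_vecs d \<gamma> v j)) 1 \<gamma>"
    "transpose_mat (prod_up n (\<lambda>j. elem_factor n w (v j)) (\<gamma> + 1) d) =
      prod_up n (\<lambda>j. elem_factor n w (dual_vecs d \<gamma> v j)) (\<gamma> + 1) d"
  by (rule transpose_prod_up[OF assms(1)]; use assms(2) in \<open>simp add: dual_vecs_def\<close>)+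

lemma transpose_mult3:
  fixes A :: "complex mat"
  assumes "A \<in> carrier_mat a b" "B \<in> carrier_mat b c" "C \<in> carrier_mat c e"
  shows "transpose_mat (A * B * C) = transpose_mat C * transpose_mat B * transpose_mat A"
proof -
  have "transpose_mat (A * B * C) = transpose_mat C * (transpose_mat B * transpose_mat A)"
    using transpose_mult[OF mult_carrier_mat[OF assms(1,2)] assms(3)] transpose_mult[OF assms(1,2)] by simp
  also have "\<dots> = transpose_mat C * transpose_mat B * transpose_mat A"
    by (rule assoc_mult_mat[symmetric]) (use assms in auto)
  finally show ?thesis .
qed

lemma transpose_forms:
  assumes v: "unit_vectors m d v" "\<gamma> \<le> d"
  shows "U \<in> carrier_mat p m \<Longrightarrow>
      transpose_mat (coiso_form1 m d \<gamma> v U z) = iso_form1 m d \<gamma> (dual_vecs d \<gamma> v) (transpose_mat U) z"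
    "U \<in> carrier_mat m p \<Longrightarrow>
      transpose_mat (iso_form1 m d \<gamma> v U z) = coiso_form1 m d \<gamma> (dual_vecs d \<gamma> v) (transpose_mat U) z"
proof -
  have c: "mat_prod m (\<lambda>j. elem_factor m w (v j)) js \<in> carrier_mat m m" for w js
    by (rule mat_prod_carrier) simp
  show "transpose_mat (coiso_form1 m d \<gamma> v U z) = iso_form1 m d \<gamma> (dual_vecs d \<gamma> v) (transpose_mat U) z"
    if "U \<in> carrier_mat p m"
    unfolding coiso_form1_def iso_form1_def transpose_mult3[OF that c c] transpose_prod_up_dual[OF v] ..
  show "transpose_mat (iso_form1 m d \<gamma> v U z) = coiso_form1 m d \<gamma> (dual_vecs d \<gamma> v) (transpose_mat U) z"
    if "U \<in> carrier_mat m p"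
    unfolding coiso_form1_def iso_form1_def transpose_mult3[OF c c that] transpose_prod_up_dual[OF v] ..
qed

lemma mat_adjoint_transpose_mult:
  "mat_adjoint (transpose_mat A) * transpose_mat A = transpose_mat (A * mat_adjoint A)" for A :: "complex mat"
  by (rule eq_matI) (auto simp: mat_adjoint_mat scalar_prod_def mult.commute)

lemma transpose_mat_eq_one_iff: "transpose_mat A = 1\<^sub>m n \<longleftrightarrow> A = 1\<^sub>m n"
  by (metis transpose_one transpose_transpose)

lemma isometric_transpose_iff:
  "isometric_on_circle p (\<lambda>z. transpose_mat (F z)) \<longleftrightarrow> (\<forall>z. cmod z = 1 \<longrightarrow> F z * mat_adjoint (F z) = 1\<^sub>m p)"
  by (simp add: isometric_on_circle_def mat_adjoint_transpose_mult transpose_mat_eq_one_iff)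

lemma iso_data_dual: "coiso_data p m d \<gamma> v U \<Longrightarrow> iso_data m p d \<gamma> (dual_vecs d \<gamma> v) (transpose_mat U)"
  unfolding iso_data_def coiso_data_def mat_adjoint_transpose_mult transpose_mat_eq_one_iff
  using unit_vectors_dual_vecs by auto

lemma coiso_data_dual:
  assumes "iso_data m p d \<gamma> v U"
  shows "coiso_data p m d \<gamma> (dual_vecs d \<gamma> v) (transpose_mat U)"
proof -
  have "transpose_mat U * mat_adjoint (transpose_mat U) = transpose_mat (mat_adjoint U * U)"
    by (rule eq_matI) (auto simp: mat_adjoint_mat scalar_prod_def mult.commute)
  then show ?thesis using assms unit_vectors_dual_vecs unfolding iso_data_def coiso_data_def by auto
qed

lemma realization_transpose:
  assumes r: "realization p m \<nu> G A B C D"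
  shows "realization m p \<nu> (\<lambda>z. transpose_mat (G z)) (transpose_mat A) (transpose_mat C) (transpose_mat B) (transpose_mat D)"
proof -
  have ABCD: "A \<in> carrier_mat \<nu> \<nu>" "B \<in> carrier_mat \<nu> m" "C \<in> carrier_mat p \<nu>" "D \<in> carrier_mat p m"
    and ev: "\<forall>\<^sub>F z in cofinite. G z = C * mat_inv (z \<cdot>\<^sub>m 1\<^sub>m \<nu> - A) * B + D"
    using r by (auto simp: realization_def)
  from ev resolvent_cofinite[OF ABCD(1)]
  have "\<forall>\<^sub>F z in cofinite. transpose_mat (G z) =
      transpose_mat B * mat_inv (z \<cdot>\<^sub>m 1\<^sub>m \<nu> - transpose_mat A) * transpose_mat C + transpose_mat D"
  proof eventually_elim
    case (elim z)
    let ?R = "z \<cdot>\<^sub>m 1\<^sub>m \<nu> - A"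
    have R: "?R \<in> carrier_mat \<nu> \<nu>" using ABCD by auto
    note X = mat_inv_det[OF R elim(2)]
    have t: "transpose_mat ?R = z \<cdot>\<^sub>m 1\<^sub>m \<nu> - transpose_mat A"
      using ABCD by (intro eq_matI) auto
    have inv: "mat_inv (transpose_mat ?R) = transpose_mat (mat_inv ?R)"
    proof (rule mat_inv_unique)
      show "transpose_mat ?R * transpose_mat (mat_inv ?R) = 1\<^sub>m \<nu>"
        using transpose_mult[OF X(1) R] X(3) by simp
    qed (use R X(1) in auto)
    have "transpose_mat (C * mat_inv ?R * B + D) = transpose_mat (C * mat_inv ?R * B) + transpose_mat D"
      by (rule transpose_add[of _ p m]) (use ABCD X(1) in auto)
    then show ?case
      unfolding elim(1) t[symmetric] inv transpose_mult3[OF ABCD(3) X(1) ABCD(2)] .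
  qed
  then show ?thesis using ABCD by (simp add: realization_def)
qed

lemma proper_mcmillan_degree_transpose:
  "proper_mcmillan_degree m p (\<lambda>z. transpose_mat (G z)) = proper_mcmillan_degree p m G"
proof -
  have "(\<exists>A B C D. realization m p \<nu> (\<lambda>z. transpose_mat (G z)) A B C D) \<longleftrightarrow> (\<exists>A B C D. realization p m \<nu> G A B C D)" for \<nu>
    using realization_transpose[of p m \<nu> G] realization_transpose[of m p \<nu> "\<lambda>z. transpose_mat (G z)"]
    unfolding transpose_transpose by blast
  then show ?thesis by (simp add: proper_mcmillan_degree_def)
qed

lemma fir_expansion_transpose:
  assumes "fir_expansion p m q n B F"
  shows "fir_expansion m p q n (\<lambda>j. transpose_mat (B j)) (\<lambda>z. transpose_mat (F z))"
  unfolding fir_expansion_def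
proof (intro conjI ballI allI impI)
  have B: "B j \<in> carrier_mat p m" if "j \<in> {1..n}" for j
    using assms that by (simp add: fir_expansion_def)
  then show "transpose_mat (B j) \<in> carrier_mat m p" if "j \<in> {1..n}" for j
    using that by simp
  fix z :: complex assume z: "z \<noteq> 0"
  have s: "(\<Sum>j=1..n. z powi (- int j) * transpose_mat (B j) $$ (i, k)) = (\<Sum>j=1..n. z powi (- int j) * B j $$ (k, i))"
    if "i < m" "k < p" for i k
  proof (rule sum.cong[OF refl])
    fix j assume "j \<in> {1..n}"
    from B[OF this] that
    show "z powi (- int j) * transpose_mat (B j) $$ (i, k) = z powi (- int j) * B j $$ (k, i)" by simp
  qed
  have "F z = mat p m (\<lambda>(i, k). z powi q * (\<Sum>j=1..n. z powi (- int j) * B j $$ (i, k)))"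
    using assms z by (simp add: fir_expansion_def)
  then show "transpose_mat (F z) = mat m p (\<lambda>(i, k). z powi q * (\<Sum>j=1..n. z powi (- int j) * transpose_mat (B j) $$ (i, k)))"
    by (intro eq_matI) (auto simp: s[unfolded One_nat_def])
qed

lemma has_mcmillan_degree_transpose:
  assumes "has_mcmillan_degree p m F d"
  shows "has_mcmillan_degree m p (\<lambda>z. transpose_mat (F z)) d"
proof -
  from assms obtain Fl D Fr where F: "strictly_anticausal p m Fl" "D \<in> carrier_mat p m" "strictly_causal p m Fr"
    "\<And>z. z \<noteq> 0 \<Longrightarrow> F z = Fl z + D + Fr z"
    "d = proper_mcmillan_degree p m Fr + proper_mcmillan_degree p m (\<lambda>z. Fl (1 / z))"
    by (auto simp: has_mcmillan_degree_def)
  have l: "strictly_anticausal m p (\<lambda>z. transpose_mat (Fl z))"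
    using F(1) fir_expansion_transpose unfolding strictly_anticausal_def by blast
  have r: "strictly_causal m p (\<lambda>z. transpose_mat (Fr z))"
    using F(3) fir_expansion_transpose unfolding strictly_causal_def by blast
  have c: "Fl z \<in> carrier_mat p m" "Fr z \<in> carrier_mat p m" if "z \<noteq> 0" for z
    using F(1,3) that by (auto simp: strictly_anticausal_def strictly_causal_def fir_expansion_def)
  have "transpose_mat (F z) = transpose_mat (Fl z) + transpose_mat D + transpose_mat (Fr z)" if "z \<noteq> 0" for z
    using F(2,4) c[OF that] that by (simp add: transpose_add[of _ p m])
  then show ?thesis
    unfolding has_mcmillan_degree_def F(5)
    using l r F(2) proper_mcmillan_degree_transpose[of m p Fr] proper_mcmillan_degree_transpose[of m p "\<lambda>z. Fl (1 / z)"]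
    by (intro exI[of _ "\<lambda>z. transpose_mat (Fl z)"] exI[of _ "transpose_mat D"] exI[of _ "\<lambda>z. transpose_mat (Fr z)"]) auto
qed

section \<open>The two characterizations\<close>

lemma isometrically_in_U_iff:
  assumes "has_mcmillan_degree p m F d" "m \<le> p"
  shows "isometrically_in_U p m F \<longleftrightarrow> (\<exists>\<gamma> v U. iso_data p m d \<gamma> v U \<and> eq_laurent F (iso_form1 p d \<gamma> v U))"
proof -
  obtain N f where "laurent_expansion p m N f F" by (rule has_mcmillan_degree_laurent_expansion[OF assms(1)])
  then have "isometrically_in_U p m F \<longleftrightarrow> isometric_on_circle m F"
    using laurent_expansion_rational_on_circle assms(2) by (auto simp: isometrically_in_U_def isometric_on_circle_def)
  then show ?thesis using isometric_iff_iso_form1[OF assms(1)] by simp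
qed

lemma coisometrically_in_U_iff:
  assumes "has_mcmillan_degree p m F d" "p \<le> m"
  shows "coisometrically_in_U p m F \<longleftrightarrow> (\<exists>\<gamma> v U. coiso_data p m d \<gamma> v U \<and> eq_laurent F (coiso_form1 m d \<gamma> v U))"
proof -
  obtain N f where "laurent_expansion p m N f F" by (rule has_mcmillan_degree_laurent_expansion[OF assms(1)])
  then have "coisometrically_in_U p m F \<longleftrightarrow> isometric_on_circle p (\<lambda>z. transpose_mat (F z))"
    using laurent_expansion_rational_on_circle assms(2) by (auto simp: coisometrically_in_U_def isometric_transpose_iff)
  also have "\<dots> \<longleftrightarrow> (\<exists>\<gamma> v U. iso_data m p d \<gamma> v U \<and> eq_laurent (\<lambda>z. transpose_mat (F z)) (iso_form1 m d \<gamma> v U))"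
    by (rule isometric_iff_iso_form1[OF has_mcmillan_degree_transpose[OF assms(1)]])
  also have "\<dots> \<longleftrightarrow> (\<exists>\<gamma> v U. coiso_data p m d \<gamma> v U \<and> eq_laurent F (coiso_form1 m d \<gamma> v U))"
  proof (intro iffI; elim exE conjE)
    fix \<gamma> v U assume d: "iso_data m p d \<gamma> v U" and F: "eq_laurent (\<lambda>z. transpose_mat (F z)) (iso_form1 m d \<gamma> v U)"
    have "F z = coiso_form1 m d \<gamma> (dual_vecs d \<gamma> v) (transpose_mat U) z" if "z \<noteq> 0" for z
    proof -
      have "F z = transpose_mat (iso_form1 m d \<gamma> v U z)"
        using F that unfolding eq_laurent_def by (metis transpose_transpose)
      then show ?thesis using d transpose_forms(2) by (metis iso_data_def)
    qed
    then show "\<exists>\<gamma> v U. coiso_data p m d \<gamma> v U \<and> eq_laurent F (coiso_form1 m d \<gamma> v U)"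
      using coiso_data_dual[OF d] unfolding eq_laurent_def by blast
  next
    fix \<gamma> v U assume d: "coiso_data p m d \<gamma> v U" and F: "eq_laurent F (coiso_form1 m d \<gamma> v U)"
    have "transpose_mat (F z) = iso_form1 m d \<gamma> (dual_vecs d \<gamma> v) (transpose_mat U) z" if "z \<noteq> 0" for z
      using F that d transpose_forms(1) unfolding eq_laurent_def by (metis coiso_data_def)
    then show "\<exists>\<gamma> v U. iso_data m p d \<gamma> v U \<and> eq_laurent (\<lambda>z. transpose_mat (F z)) (iso_form1 m d \<gamma> v U)"
      using iso_data_dual[OF d] unfolding eq_laurent_def by blast
  qed
  finally show ?thesis .
qed

theorem theorem3p5:
  fixes F :: "complex \<Rightarrow> complex mat" and p m d :: nat
  assumes "fir p m F"
    and "has_mcmillan_degree p m F d"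
  shows
    "(m \<le> p \<longrightarrow>
      (isometrically_in_U p m F \<longleftrightarrow>
         (\<exists>\<gamma> v U. iso_data p m d \<gamma> v U \<and> eq_laurent F (iso_form1 p d \<gamma> v U))) \<and>
      (isometrically_in_U p m F \<longleftrightarrow>
         (\<exists>\<gamma> v U. iso_data p m d \<gamma> v U \<and> eq_laurent F (iso_form2 p d \<gamma> v U))) \<and>
      (isometrically_in_U p m F \<longleftrightarrow>
         (\<exists>\<gamma> v U. iso_data p m d \<gamma> v U \<and> eq_laurent F (iso_form3 p d \<gamma> v U))) \<and>
      (\<forall>\<gamma> v U. iso_data p m d \<gamma> v U \<longrightarrow>
         (eq_laurent F (iso_form1 p d \<gamma> v U) \<longleftrightarrow> eq_laurent F (iso_form2 p d \<gamma> v U)) \<and>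
         (eq_laurent F (iso_form2 p d \<gamma> v U) \<longleftrightarrow> eq_laurent F (iso_form3 p d \<gamma> v U)) \<and>
         (eq_laurent F (iso_form1 p d \<gamma> v U) \<or>
          eq_laurent F (iso_form2 p d \<gamma> v U) \<or>
          eq_laurent F (iso_form3 p d \<gamma> v U) \<longrightarrow>
            (\<gamma> = 0 \<longrightarrow> causal p m F) \<and> (\<gamma> = d \<longrightarrow> anticausal p m F)))) \<and>
     (p \<le> m \<longrightarrow>
      (coisometrically_in_U p m F \<longleftrightarrow>
         (\<exists>\<gamma> v U. coiso_data p m d \<gamma> v U \<and> eq_laurent F (coiso_form1 m d \<gamma> v U))) \<and>
      (coisometrically_in_U p m F \<longleftrightarrow>
         (\<exists>\<gamma> v U. coiso_data p m d \<gamma> v U \<and> eq_laurent F (coiso_form2 m d \<gamma> v U))) \<and>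
      (coisometrically_in_U p m F \<longleftrightarrow>
         (\<exists>\<gamma> v U. coiso_data p m d \<gamma> v U \<and> eq_laurent F (coiso_form3 m d \<gamma> v U))) \<and>
      (\<forall>\<gamma> v U. coiso_data p m d \<gamma> v U \<longrightarrow>
         (eq_laurent F (coiso_form1 m d \<gamma> v U) \<longleftrightarrow> eq_laurent F (coiso_form2 m d \<gamma> v U)) \<and>
         (eq_laurent F (coiso_form2 m d \<gamma> v U) \<longleftrightarrow> eq_laurent F (coiso_form3 m d \<gamma> v U)) \<and>
         (eq_laurent F (coiso_form1 m d \<gamma> v U) \<or>
          eq_laurent F (coiso_form2 m d \<gamma> v U) \<or>
          eq_laurent F (coiso_form3 m d \<gamma> v U) \<longrightarrow>
            (\<gamma> = 0 \<longrightarrow> causal p m F) \<and> (\<gamma> = d \<longrightarrow> anticausal p m F))))"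
proof -
  have iso: "(eq_laurent F (iso_form1 p d \<gamma> v U) \<longleftrightarrow> eq_laurent F (iso_form2 p d \<gamma> v U)) \<and>
      (eq_laurent F (iso_form1 p d \<gamma> v U) \<longleftrightarrow> eq_laurent F (iso_form3 p d \<gamma> v U))" if "iso_data p m d \<gamma> v U" for \<gamma> v U
    using iso_forms_eq[OF that] by (simp add: eq_laurent_def)
  have coiso: "(eq_laurent F (coiso_form1 m d \<gamma> v U) \<longleftrightarrow> eq_laurent F (coiso_form2 m d \<gamma> v U)) \<and>
      (eq_laurent F (coiso_form1 m d \<gamma> v U) \<longleftrightarrow> eq_laurent F (coiso_form3 m d \<gamma> v U))" if "coiso_data p m d \<gamma> v U" for \<gamma> v U
    using coiso_forms_eq[OF that] by (simp add: eq_laurent_def)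
  note I = isometrically_in_U_iff[OF assms(2)] and C = coisometrically_in_U_iff[OF assms(2)]
  show ?thesis
  proof (intro conjI impI)
    assume "m \<le> p"
    note I = I[OF this]
    show "isometrically_in_U p m F \<longleftrightarrow> (\<exists>\<gamma> v U. iso_data p m d \<gamma> v U \<and> eq_laurent F (iso_form1 p d \<gamma> v U))"
      by (rule I)
    show "isometrically_in_U p m F \<longleftrightarrow> (\<exists>\<gamma> v U. iso_data p m d \<gamma> v U \<and> eq_laurent F (iso_form2 p d \<gamma> v U))"
      unfolding I using iso by blast
    show "isometrically_in_U p m F \<longleftrightarrow> (\<exists>\<gamma> v U. iso_data p m d \<gamma> v U \<and> eq_laurent F (iso_form3 p d \<gamma> v U))"
      unfolding I using iso by blast
    show "\<forall>\<gamma> v U. iso_data p m d \<gamma> v U \<longrightarrow>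
         (eq_laurent F (iso_form1 p d \<gamma> v U) \<longleftrightarrow> eq_laurent F (iso_form2 p d \<gamma> v U)) \<and>
         (eq_laurent F (iso_form2 p d \<gamma> v U) \<longleftrightarrow> eq_laurent F (iso_form3 p d \<gamma> v U)) \<and>
         (eq_laurent F (iso_form1 p d \<gamma> v U) \<or>
          eq_laurent F (iso_form2 p d \<gamma> v U) \<or>
          eq_laurent F (iso_form3 p d \<gamma> v U) \<longrightarrow>
            (\<gamma> = 0 \<longrightarrow> causal p m F) \<and> (\<gamma> = d \<longrightarrow> anticausal p m F))"
      using iso iso_form1_causal by blast
  next
    assume "p \<le> m"
    note C = C[OF this]
    show "coisometrically_in_U p m F \<longleftrightarrow> (\<exists>\<gamma> v U. coiso_data p m d \<gamma> v U \<and> eq_laurent F (coiso_form1 m d \<gamma> v U))"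
      by (rule C)
    show "coisometrically_in_U p m F \<longleftrightarrow> (\<exists>\<gamma> v U. coiso_data p m d \<gamma> v U \<and> eq_laurent F (coiso_form2 m d \<gamma> v U))"
      unfolding C using coiso by blast
    show "coisometrically_in_U p m F \<longleftrightarrow> (\<exists>\<gamma> v U. coiso_data p m d \<gamma> v U \<and> eq_laurent F (coiso_form3 m d \<gamma> v U))"
      unfolding C using coiso by blast
    show "\<forall>\<gamma> v U. coiso_data p m d \<gamma> v U \<longrightarrow>
         (eq_laurent F (coiso_form1 m d \<gamma> v U) \<longleftrightarrow> eq_laurent F (coiso_form2 m d \<gamma> v U)) \<and>
         (eq_laurent F (coiso_form2 m d \<gamma> v U) \<longleftrightarrow> eq_laurent F (coiso_form3 m d \<gamma> v U)) \<and>
         (eq_laurent F (coiso_form1 m d \<gamma> v U) \<or>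
          eq_laurent F (coiso_form2 m d \<gamma> v U) \<or>
          eq_laurent F (coiso_form3 m d \<gamma> v U) \<longrightarrow>
            (\<gamma> = 0 \<longrightarrow> causal p m F) \<and> (\<gamma> = d \<longrightarrow> anticausal p m F))"
      using coiso coiso_form1_causal by blast
  qed
qed

end
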